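(* Let $(a,b)\subset\mathbb{R}$ be a finite interval, $m,n\in\mathbb{N}$, $\varepsilon_0>0$. For each $\varepsilon\in[0,\varepsilon_0)$ let $A(\cdot;\varepsilon)\in (W^{n-1}_\infty)^{m\times m}$ and let $B(\varepsilon)\colon (W^n_\infty)^m\to\mathbb{C}^m$ be a bounded linear operator; let $L(\varepsilon)y:=y'+A(\cdot;\varepsilon)y$ and $(L(\varepsilon),B(\varepsilon))\colon (W^n_\infty)^m\to (W^{n-1}_\infty)^m\times\mathbb{C}^m$, $y\mapsto (L(\varepsilon)y,B(\varepsilon)y)$. Assume that $(L(0),B(0))$ is invertible. Then the following are equivalent as $\varepsilon\to0+$: (i) $(L(\varepsilon),B(\varepsilon))$ is invertible for all sufficiently small $\varepsilon$ and $(L(\varepsilon),B(\varepsilon))^{-1}\to (L(0),B(0))^{-1}$ in the strong operator topology; (ii) $(L(\varepsilon),B(\varepsilon))\to(L(0),B(0))$ in the strong operator topology.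
   Context: For an integer $k\ge0$, $W^k_\infty=W^k_\infty([a,b];\mathbb{C})$ is the Sobolev space of complex functions on $[a,b]$ whose derivatives up to order $k$ are essentially bounded, with norm $\|y\|_{k,\infty}=\sum_{j=0}^k\|y^{(j)}\|_{L_\infty}$; $W^0_\infty=L_\infty$. $(W^k_\infty)^m$, $(W^k_\infty)^{m\times m}$ denote vector/matrix functions with components in $W^k_\infty$, normed componentwise. Strong operator convergence $T_\varepsilon\to T$ means $T_\varepsilon x\to Tx$ in norm for every $x$. *)

theory Defs
  imports "HOL-Probability.Probability"
begin

text \<open>Functions on the interval [a,b] are represented by functions real => 'v; elements of
  the Sobolev spaces are identified when they agree almost everywhere on [a,b].\<close>

definition aeq :: "real \<Rightarrow> real \<Rightarrow> (real \<Rightarrow> 'v) \<Rightarrow> (real \<Rightarrow> 'v) \<Rightarrow> bool" where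
  "aeq a b y z \<longleftrightarrow> (AE x in lebesgue_on {a..b}. y x = z x)"

definition Linf :: "real \<Rightarrow> real \<Rightarrow> (real \<Rightarrow> 'v::euclidean_space) \<Rightarrow> bool" where
  "Linf a b g \<longleftrightarrow> g \<in> borel_measurable (lebesgue_on {a..b}) \<and>
     esssup (lebesgue_on {a..b}) (\<lambda>x. ereal (norm (g x))) < \<infinity>"

text \<open>G is a chain of (weak) derivatives of y up to order k, all essentially bounded:
  G 0 = y a.e., and G j is absolutely continuous with derivative G (j+1) for j < k.\<close>
definition sob_chain :: "real \<Rightarrow> real \<Rightarrow> nat \<Rightarrow> (real \<Rightarrow> 'v::euclidean_space) \<Rightarrow> (nat \<Rightarrow> real \<Rightarrow> 'v) \<Rightarrow> bool" where
  "sob_chain a b k y G \<longleftrightarrow>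
     (\<forall>j\<le>k. Linf a b (G j)) \<and> aeq a b y (G 0) \<and>
     (\<forall>j<k. G (Suc j) integrable_on {a..b} \<and>
        (\<forall>x\<in>{a..b}. G j x = G j a + integral {a..x} (G (Suc j))))"

definition Wk :: "real \<Rightarrow> real \<Rightarrow> nat \<Rightarrow> (real \<Rightarrow> 'v::euclidean_space) \<Rightarrow> bool" where
  "Wk a b k y \<longleftrightarrow> (\<exists>G. sob_chain a b k y G)"

definition linf_norm :: "real \<Rightarrow> real \<Rightarrow> (real \<Rightarrow> complex ^ 'm) \<Rightarrow> real" where
  "linf_norm a b g =
     (\<Sum>i\<in>UNIV. real_of_ereal (esssup (lebesgue_on {a..b}) (\<lambda>x. ereal (cmod (g x $ i)))))"

text \<open>The norm of (W^k_infinity)^m: sum over j <= k of the L-infinity norms of y^(j)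
  (the derivative chain is unique a.e., so the infimum is attained by it).\<close>
definition wnorm :: "real \<Rightarrow> real \<Rightarrow> nat \<Rightarrow> (real \<Rightarrow> complex ^ 'm) \<Rightarrow> real" where
  "wnorm a b k y = Inf {(\<Sum>j\<le>k. linf_norm a b (G j)) | G. sob_chain a b k y G}"

definition wderiv :: "real \<Rightarrow> real \<Rightarrow> (real \<Rightarrow> complex ^ 'm) \<Rightarrow> real \<Rightarrow> complex ^ 'm" where
  "wderiv a b y = (SOME G. sob_chain a b 1 y G) 1"

definition Lop :: "real \<Rightarrow> real \<Rightarrow> (real \<Rightarrow> complex ^ 'm ^ 'm) \<Rightarrow> (real \<Rightarrow> complex ^ 'm) \<Rightarrow> real \<Rightarrow> complex ^ 'm" where
  "Lop a b A y = (\<lambda>x. wderiv a b y x + A x *v y x)"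

definition bdd_lin_B :: "real \<Rightarrow> real \<Rightarrow> nat \<Rightarrow> ((real \<Rightarrow> complex ^ 'm) \<Rightarrow> complex ^ 'm) \<Rightarrow> bool" where
  "bdd_lin_B a b n B \<longleftrightarrow>
     (\<forall>y z. Wk a b n y \<longrightarrow> Wk a b n z \<longrightarrow> aeq a b y z \<longrightarrow> B y = B z) \<and>
     (\<forall>y z c. Wk a b n y \<longrightarrow> Wk a b n z \<longrightarrow> B (\<lambda>x. c *s y x + z x) = c *s B y + B z) \<and>
     (\<exists>C. \<forall>y. Wk a b n y \<longrightarrow> norm (B y) \<le> C * wnorm a b n y)"

definition is_inverse :: "real \<Rightarrow> real \<Rightarrow> nat \<Rightarrow> (real \<Rightarrow> complex ^ 'm ^ 'm) \<Rightarrow>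
    ((real \<Rightarrow> complex ^ 'm) \<Rightarrow> complex ^ 'm) \<Rightarrow>
    ((real \<Rightarrow> complex ^ 'm) \<Rightarrow> complex ^ 'm \<Rightarrow> real \<Rightarrow> complex ^ 'm) \<Rightarrow> bool" where
  "is_inverse a b n A B S \<longleftrightarrow>
     (\<forall>f c. Wk a b (n - 1) f \<longrightarrow> Wk a b n (S f c)) \<and>
     (\<forall>f g c. Wk a b (n - 1) f \<longrightarrow> Wk a b (n - 1) g \<longrightarrow> aeq a b f g \<longrightarrow> aeq a b (S f c) (S g c)) \<and>
     (\<forall>f g c d \<alpha>. Wk a b (n - 1) f \<longrightarrow> Wk a b (n - 1) g \<longrightarrow>
        aeq a b (S (\<lambda>x. \<alpha> *s f x + g x) (\<alpha> *s c + d)) (\<lambda>x. \<alpha> *s S f c x + S g d x)) \<and>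
     (\<exists>C. \<forall>f c. Wk a b (n - 1) f \<longrightarrow> wnorm a b n (S f c) \<le> C * (wnorm a b (n - 1) f + norm c)) \<and>
     (\<forall>y. Wk a b n y \<longrightarrow> aeq a b (S (Lop a b A y) (B y)) y) \<and>
     (\<forall>f c. Wk a b (n - 1) f \<longrightarrow> aeq a b (Lop a b A (S f c)) f \<and> B (S f c) = c)"

end

theory Submission
  imports Defs
begin

text \<open>
  Applied to constant functions, strong convergence of \<open>L(\<epsilon>)\<close> gives convergence of the columns of
  \<open>A(\<epsilon>)\<close>, hence norm convergence of \<open>L(\<epsilon>)\<close>; only the functionals \<open>B(\<epsilon>)\<close> converge merely
  strongly, and they are uniformly bounded by Banach--Steinhaus.

  If the operators converge, write \<open>S\<^sub>0\<close> for the inverse at \<open>0\<close>, so that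
  \<open>S\<^sub>0 (L(\<epsilon>), B(\<epsilon>)) = I + K(\<epsilon>)\<close> with \<open>K(\<epsilon>) y = S\<^sub>0 ((A(\<epsilon>) - A(0)) y, (B(\<epsilon>) - B(0)) y)\<close>. The
  perturbation \<open>K(\<epsilon>)\<close> need not be small, but \<open>K(\<epsilon>)\<^sup>2\<close> tends to \<open>0\<close> in norm, because the range of
  \<open>S\<^sub>0 (0, \<cdot>)\<close> is finite-dimensional and \<open>B(\<epsilon>) - B(0)\<close> converges to \<open>0\<close> uniformly on its unit ball.
  So the Neumann series of \<open>I + K(\<epsilon>)\<close> converges.

  If the inverses \<open>S\<^sub>\<epsilon>\<close> converge, let \<open>v\<^sub>j = S\<^sub>\<epsilon> (L(0) e\<^sub>j, B(0) e\<^sub>j)\<close>, which tends to the constant \<open>e\<^sub>j\<close>. Since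
  \<open>L(\<epsilon>) v\<^sub>j = L(0) e\<^sub>j\<close>, the \<open>j\<close>th column of \<open>A(\<epsilon>) - A(0)\<close> is \<open>- L(\<epsilon>) (v\<^sub>j - e\<^sub>j)\<close>, and absorbing the
  contribution of \<open>A(\<epsilon>) - A(0)\<close> on the right gives \<open>A(\<epsilon>) \<rightarrow> A(0)\<close>. For \<open>w = B(\<epsilon>) y - B(0) y\<close> one finds
  \<open>S\<^sub>\<epsilon> (0, w) \<rightarrow> 0\<close>, using Banach--Steinhaus for \<open>S\<^sub>\<epsilon> (\<cdot>, 0)\<close>; as \<open>B(0) S\<^sub>\<epsilon> (0, \<cdot>)\<close> tends to the identity
  matrix, \<open>w \<rightarrow> 0\<close>.
\<close>

section \<open>Scaling, linear maps and limits for vectors with complex components\<close>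

lemma norm_vector_smult: "norm (c *s v) = cmod c * norm (v :: complex ^ 'm)"
proof -
  have "norm (c *s v) = L2_set (\<lambda>i. cmod c * cmod (v $ i)) UNIV"
    by (simp add: norm_vec_def norm_mult)
  also have "\<dots> = cmod c * norm v"
    unfolding norm_vec_def by (rule L2_set_right_distrib [symmetric]) simp
  finally show ?thesis .
qed

text \<open>A matrix-vector product is a sum of such products of a component with a column, so
  bilinearity here is what brings the general product rule to \<open>A x *v y x\<close>.\<close>

lemma bounded_bilinear_component_smult:
  "bounded_bilinear (\<lambda>(w :: complex ^ 'm) v :: complex ^ 'm. w $ i *s v)"
proof
  show "\<exists>K. \<forall>(w :: complex ^ 'm) v :: complex ^ 'm. norm (w $ i *s v) \<le> norm w * norm v * K"
    by (rule exI [of _ 1]) (auto simp: norm_vector_smult Finite_Cartesian_Product.norm_nth_le intro!: mult_right_mono)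
qed (simp_all add: vec_eq_iff algebra_simps)

lemma bounded_linear_smult: "bounded_linear (\<lambda>v :: complex ^ 'm. c *s v)"
  by (rule bounded_linear_intro [where K = "cmod c"])
    (simp_all add: norm_vector_smult vec_eq_iff algebra_simps)

lemma bounded_linear_axis: "bounded_linear (axis i :: complex \<Rightarrow> complex ^ 'm)"
  unfolding linear_conv_bounded_linear [symmetric]
  by (rule linearI) (simp_all add: vec_eq_iff axis_def)

lemma null_sequence_comparison:
  fixes f :: "nat \<Rightarrow> 'v :: real_normed_vector"
  assumes "\<And>n. norm (f n) \<le> g n" "g \<longlonglongrightarrow> 0"
  shows "f \<longlonglongrightarrow> 0"
  by (rule Lim_null_comparison [OF always_eventually [OF allI] assms(2)]) (rule assms(1))

text \<open>Expanding \<open>v\<close> in the standard basis bounds the whole map by its values at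
  finitely many vectors. Through this bound, convergence at each basis vector becomes uniform on the
  unit ball.\<close>

lemma complex_linear_bound:
  fixes G :: "complex ^ 'm \<Rightarrow> complex ^ 'm"
  assumes "\<And>c v w. G (c *s v + w) = c *s G v + G w"
  shows "norm (G v) \<le> (\<Sum>j\<in>UNIV. norm (G (axis j 1))) * norm v"
proof -
  have zero: "G 0 = 0"
    using assms [of 1 0 0] by simp
  have "G (\<Sum>j\<in>I. v $ j *s axis j 1) = (\<Sum>j\<in>I. v $ j *s G (axis j 1))" if "finite I" for I
    using that by (induction I rule: finite_induct) (simp_all add: assms zero)
  then have "G v = (\<Sum>j\<in>UNIV. v $ j *s G (axis j 1))"
    by (metis basis_expansion finite)
  also have "norm \<dots> \<le> (\<Sum>j\<in>UNIV. norm (v $ j *s G (axis j 1)))"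
    by (rule norm_sum)
  also have "\<dots> \<le> (\<Sum>j\<in>UNIV. norm (G (axis j 1)) * norm v)"
    by (intro sum_mono) (auto simp: norm_vector_smult mult.commute [of _ "norm v"] intro!: mult_right_mono Finite_Cartesian_Product.norm_nth_le)
  finally show ?thesis
    by (simp add: sum_distrib_right)
qed

lemma eventually_at_right_0: "0 < \<delta> \<Longrightarrow> \<forall>\<^sub>F e in at_right (0 :: real). 0 < e \<and> e < \<delta>"
  by (auto simp: eventually_at_right_field intro: exI [of _ \<delta>])

lemma matrix_vector_axis: "(M :: complex ^ 'm ^ 'm) *v axis j 1 = column j M"
  by (simp add: matrix_vector_mult_def column_def axis_def vec_eq_iff if_distrib [of "\<lambda>z. _ * z"] cong: if_cong)

locale interval =
  fixes a b :: real
  assumes ab: "a < b"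
begin

abbreviation "ae P \<equiv> (AE x in lebesgue_on {a..b}. P x)"

subsection \<open>Essentially bounded functions\<close>

text \<open>The chains are built with gauge integrals, whose lemmas speak of
  \<open>negligible\<close> sets, whereas \<open>aeq\<close> and \<open>esssup\<close> refer to a
  measure. This equivalence is the bridge.\<close>

lemma ae_iff: "ae P \<longleftrightarrow> (\<exists>N. negligible N \<and> (\<forall>x\<in>{a..b} - N. P x))"
proof
  assume "ae P"
  then have "AE x in lebesgue. x \<in> {a..b} \<longrightarrow> P x"
    by (subst (asm) AE_restrict_space_iff) auto
  then show "\<exists>N. negligible N \<and> (\<forall>x\<in>{a..b} - N. P x)"
    unfolding eventually_ae_filter negligible_iff_null_sets by (elim bexE, intro exI) auto
next
  assume "\<exists>N. negligible N \<and> (\<forall>x\<in>{a..b} - N. P x)"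
  then have "AE x in lebesgue. x \<in> {a..b} \<longrightarrow> P x"
    unfolding eventually_ae_filter negligible_iff_null_sets by (elim exE conjE, intro bexI) auto
  then show "ae P"
    by (subst AE_restrict_space_iff) auto
qed

lemma ae_I: "(\<And>x. x \<in> {a..b} \<Longrightarrow> P x) \<Longrightarrow> ae P"
  by (rule AE_I2) simp

lemma ae_in: "ae (\<lambda>x. x \<in> {a..b})"
  by (rule ae_I)

lemma ae_ex:
  assumes "ae P"
  shows "\<exists>x\<in>{a..b}. P x"
proof (rule ccontr)
  assume "\<not> ?thesis"
  moreover obtain N where "negligible N" "\<forall>x\<in>{a..b} - N. P x"
    using assms ae_iff by auto
  ultimately have "negligible {a..b}"
    by (meson DiffI negligible_subset subsetI)
  then show False
    using ab negligible_interval(1) [of a b] by simp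
qed

lemma aeq_refl [simp]: "aeq a b y y"
  by (simp add: aeq_def)

lemma aeq_sym: "aeq a b y z \<Longrightarrow> aeq a b z y"
  unfolding aeq_def by (erule eventually_mono) simp

lemma aeq_trans: "aeq a b y z \<Longrightarrow> aeq a b z w \<Longrightarrow> aeq a b y w"
  unfolding aeq_def by (erule (1) eventually_elim2) simp

text \<open>Lebesgue measure is complete, so changing a measurable function on a null set keeps it
  measurable. Extension by zero moves the question from the interval to the whole line.\<close>

lemma aeq_measurable:
  assumes "aeq a b y z" "y \<in> borel_measurable (lebesgue_on {a..b})"
  shows "(z :: real \<Rightarrow> 'v :: euclidean_space) \<in> borel_measurable (lebesgue_on {a..b})"
proof -
  let ?r = "\<lambda>f x. if x \<in> {a..b} then f x else (0 :: 'v)"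
  have "AE x in lebesgue. x \<in> {a..b} \<longrightarrow> y x = z x"
    using assms(1) unfolding aeq_def by (subst (asm) AE_restrict_space_iff) auto
  then have "AE x in lebesgue. ?r y x = ?r z x"
    by (rule eventually_mono) auto
  moreover have "?r y \<in> borel_measurable lebesgue"
    by (rule borel_measurable_if_I [OF assms(2)]) simp
  ultimately have "?r z \<in> borel_measurable lebesgue"
    by (intro borel_measurable_AE [of "?r y" "?r z"])
  then show ?thesis
    by (rule borel_measurable_if_D)
qed

lemma Linf_iff:
  "Linf a b g \<longleftrightarrow> g \<in> borel_measurable (lebesgue_on {a..b}) \<and> (\<exists>C. ae (\<lambda>x. norm (g x) \<le> C))"
proof (intro iffI conjI)
  assume L: "Linf a b g"
  then show m: "g \<in> borel_measurable (lebesgue_on {a..b})"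
    by (simp add: Linf_def)
  let ?e = "esssup (lebesgue_on {a..b}) (\<lambda>x. ereal (norm (g x)))"
  have e: "ae (\<lambda>x. ereal (norm (g x)) \<le> ?e)"
    by (rule esssup_AE)
  have "\<exists>r. ?e \<le> ereal r"
    using L unfolding Linf_def by (cases ?e) auto
  then obtain r where "?e \<le> ereal r" ..
  then have "ae (\<lambda>x. norm (g x) \<le> r)"
    using e by (auto elim!: eventually_mono dest: order_trans)
  then show "\<exists>C. ae (\<lambda>x. norm (g x) \<le> C)" ..
next
  assume "g \<in> borel_measurable (lebesgue_on {a..b}) \<and> (\<exists>C. ae (\<lambda>x. norm (g x) \<le> C))"
  then obtain C where C: "g \<in> borel_measurable (lebesgue_on {a..b})" "ae (\<lambda>x. norm (g x) \<le> C)"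
    by auto
  then have "esssup (lebesgue_on {a..b}) (\<lambda>x. ereal (norm (g x))) \<le> ereal C"
    by (intro esssup_I) auto
  then show "Linf a b g"
    using C by (auto simp: Linf_def intro: le_less_trans)
qed

lemma Linf_bound: "Linf a b g \<Longrightarrow> \<exists>C. ae (\<lambda>x. norm (g x) \<le> C)"
  by (simp add: Linf_iff)

lemma Linf_measurable: "Linf a b g \<Longrightarrow> g \<in> borel_measurable (lebesgue_on {a..b})"
  by (simp add: Linf_iff)

lemma Linf_I:
  "g \<in> borel_measurable (lebesgue_on {a..b}) \<Longrightarrow> ae (\<lambda>x. norm (g x) \<le> C) \<Longrightarrow> Linf a b g"
  by (auto simp: Linf_iff)

lemma Linf_aeq:
  assumes y: "Linf a b y" and z: "aeq a b y z"
  shows "Linf a b z"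
proof -
  obtain C where "ae (\<lambda>x. norm (y x) \<le> C)"
    using Linf_bound [OF y] ..
  then have "ae (\<lambda>x. norm (z x) \<le> C)"
    using z unfolding aeq_def by eventually_elim simp
  then show ?thesis
    by (rule Linf_I [OF aeq_measurable [OF z Linf_measurable [OF y]]])
qed

lemma Linf_bounded_linear:
  assumes h: "bounded_linear h" and g: "Linf a b g"
  shows "Linf a b (\<lambda>x. h (g x))"
proof -
  obtain K where K: "\<And>x. norm (h x) \<le> norm x * K" "0 \<le> K"
    using bounded_linear.nonneg_bounded [OF h] by auto
  obtain C where C: "ae (\<lambda>x. norm (g x) \<le> C)"
    using Linf_bound [OF g] ..
  have "ae (\<lambda>x. norm (h (g x)) \<le> C * K)"
    using C by eventually_elim (meson K mult_right_mono order_trans)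
  moreover have "(\<lambda>x. h (g x)) \<in> borel_measurable (lebesgue_on {a..b})"
    by (rule borel_measurable_continuous_on [OF linear_continuous_on [OF h] Linf_measurable [OF g]])
  ultimately show ?thesis
    by (intro Linf_I)
qed

lemma Linf_bounded_bilinear:
  assumes h: "bounded_bilinear h" and f: "Linf a b f" and g: "Linf a b g"
  shows "Linf a b (\<lambda>x. h (f x) (g x))"
proof -
  obtain K where K: "\<And>x y. norm (h x y) \<le> norm x * norm y * K" "0 \<le> K"
    using bounded_bilinear.nonneg_bounded [OF h] by auto
  obtain C D where C: "ae (\<lambda>x. norm (f x) \<le> C)" and D: "ae (\<lambda>x. norm (g x) \<le> D)"
    using Linf_bound [OF f] Linf_bound [OF g] by blast
  have "ae (\<lambda>x. norm (h (f x) (g x)) \<le> C * D * K)"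
    using C D
  proof eventually_elim
    case (elim x)
    have "norm (f x) * norm (g x) \<le> C * D"
      using elim by (intro mult_mono) (auto intro: order_trans [OF norm_ge_zero])
    then show ?case
      by (meson K mult_right_mono order_trans)
  qed
  moreover have "(\<lambda>x. h (f x) (g x)) \<in> borel_measurable (lebesgue_on {a..b})"
    using Linf_measurable [OF f] Linf_measurable [OF g]
    by (rule borel_measurable_continuous_Pair) (intro bounded_bilinear.continuous_on [OF h] continuous_intros)
  ultimately show ?thesis
    by (intro Linf_I)
qed

lemma Linf_add:
  assumes f: "Linf a b f" and g: "Linf a b g"
  shows "Linf a b (\<lambda>x. f x + g x)"
proof -
  obtain C D where C: "ae (\<lambda>x. norm (f x) \<le> C)" and D: "ae (\<lambda>x. norm (g x) \<le> D)"
    using Linf_bound [OF f] Linf_bound [OF g] by blast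
  have "ae (\<lambda>x. norm (f x + g x) \<le> C + D)"
    using C D by eventually_elim (rule norm_triangle_mono)
  then show ?thesis
    using Linf_measurable [OF f] Linf_measurable [OF g] by (intro Linf_I) auto
qed

lemma Linf_continuous:
  assumes "continuous_on {a..b} f"
  shows "Linf a b f"
proof -
  have "compact (f ` {a..b})"
    using assms by (rule compact_continuous_image) simp
  then obtain C where "\<forall>x\<in>{a..b}. norm (f x) \<le> C"
    using compact_imp_bounded bounded_iff by (metis imageI)
  then have "ae (\<lambda>x. norm (f x) \<le> C)"
    by (intro ae_I) auto
  then show ?thesis
    by (intro Linf_I continuous_imp_measurable_on_sets_lebesgue [OF assms]) auto
qed

lemma Linf_integrable:
  assumes f: "Linf a b f"
  shows "f integrable_on {a..b}"
proof -
  obtain C where C: "ae (\<lambda>x. norm (f x) \<le> C)"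
    using Linf_bound [OF f] ..
  interpret finite_measure "lebesgue_on {a..b}"
    by (rule finite_measure_lebesgue_on) simp
  have "integrable (lebesgue_on {a..b}) f"
    using C Linf_measurable [OF f] by (rule integrable_const_bound)
  then show ?thesis
    by (rule integrable_on_lebesgue_on) simp
qed

lemma Linf_integrable_sub: "Linf a b f \<Longrightarrow> {x..y} \<subseteq> {a..b} \<Longrightarrow> f integrable_on {x..y}"
  using Linf_integrable integrable_subinterval_real by blast

lemma integral_aeq:
  assumes "aeq a b f g" "{x..y} \<subseteq> {a..b}"
  shows "integral {x..y} f = integral {x..y} g"
proof -
  obtain N where "negligible N" "\<forall>x\<in>{a..b} - N. f x = g x"
    using assms(1) unfolding aeq_def ae_iff by auto
  then show ?thesis
    using assms(2) by (intro integral_spike [of N]) auto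
qed

lemma norm_integral_ae_bound:
  assumes f: "Linf a b f" and "0 \<le> C" and C: "ae (\<lambda>r. r \<in> {x..y} \<longrightarrow> norm (f r) \<le> C)"
    and xy: "a \<le> x" "x \<le> y" "y \<le> b"
  shows "norm (integral {x..y} f) \<le> C * (y - x)"
proof -
  obtain N where N: "negligible N" "\<forall>r\<in>{a..b} - N. r \<in> {x..y} \<longrightarrow> norm (f r) \<le> C"
    using C unfolding ae_iff by auto
  \<comment> \<open>The estimate for gauge integrals wants its bound at every point, so the
    integrand is set to 0 on the null set.\<close>
  define g where "g = (\<lambda>x. if x \<in> N then 0 else f x)"
  have "integral {x..y} f = integral {x..y} g"
    using N by (intro integral_spike [of N]) (auto simp: g_def)
  moreover have "g integrable_on {x..y}"
    using Linf_integrable_sub [OF f, of x y] N xy by (auto intro: integrable_spike [of _ _ N] simp: g_def)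
  then have "(g has_integral integral {x..y} g) (cbox x y)"
    by auto
  then have "norm (integral {x..y} g) \<le> C * measure lborel (cbox x y)"
    by (rule has_integral_bound [OF \<open>0 \<le> C\<close>]) (use \<open>0 \<le> C\<close> N xy in \<open>auto simp: g_def\<close>)
  ultimately show ?thesis
    using xy by simp
qed

text \<open>By Lebesgue differentiation, the difference quotients of an indefinite integral tend
  almost everywhere to the integrand; here all these quotients vanish.\<close>

lemma integral_zero_imp_ae_zero:
  fixes f :: "real \<Rightarrow> 'v :: euclidean_space"
  assumes f: "f integrable_on {a..b}" and z: "\<And>x. x \<in> {a..b} \<Longrightarrow> integral {a..x} f = 0"
  shows "ae (\<lambda>x. f x = 0)"
proof -
  define g where "g = (\<lambda>x. if x \<in> {a..b} then f x else 0)"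
  have "g integrable_on cbox c d" for c d
    using integrable_on_subcbox integrable_restrict_UNIV f g_def by (metis subset_UNIV)
  then obtain N where N: "negligible N"
    "\<And>x e. \<lbrakk>x \<notin> N; 0 < e\<rbrakk> \<Longrightarrow> \<exists>d>0. \<forall>h. 0 < h \<and> h < d \<longrightarrow>
        norm (integral (cbox x (x + h *\<^sub>R One)) g /\<^sub>R h ^ DIM(real) - g x) < e"
    using integrable_ccontinuous_explicit [of g] by metis
  \<comment> \<open>The quotients look to the right of \<open>x\<close>, so \<open>b\<close> is
    excluded to leave room for an increment \<open>h\<close> with
    \<open>x + h \<le> b\<close>.\<close>
  have "f x = 0" if x: "x \<in> {a..b} - insert b N" for x
  proof (rule ccontr)
    assume "f x \<noteq> 0"
    then obtain d where d: "d > 0" "\<And>h. 0 < h \<Longrightarrow> h < d \<Longrightarrow>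
        norm (integral (cbox x (x + h *\<^sub>R One)) g /\<^sub>R h ^ DIM(real) - g x) < norm (f x)"
      using N(2) [of x "norm (f x)"] x by auto
    define h where "h = min (d / 2) (b - x)"
    have h: "0 < h" "h < d" "x + h \<le> b"
      using d x by (auto simp: h_def)
    have "integral {x..x + h} g = integral {x..x + h} f"
      using h x by (intro integral_cong) (auto simp: g_def)
    also have "\<dots> = integral {a..x + h} f - integral {a..x} f"
      using Henstock_Kurzweil_Integration.integral_combine [where a = a and b = "x + h" and c = x and f = f] h x
        integrable_subinterval_real [OF f, of a "x + h"] by (simp add: algebra_simps)
    also have "\<dots> = 0"
      using z h x by simp
    finally show False
      using d(2) [OF h(1,2)] x by (simp add: g_def)
  qed
  then show ?thesis
    using N(1) by (intro ae_iff [THEN iffD2] exI [of _ "insert b N"]) (auto simp: negligible_insert)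
qed

subsection \<open>Weak derivatives\<close>

text \<open>The norm of the difference is continuous and nonnegative with integral 0, hence zero at
  every point.\<close>

lemma continuous_ae_eq:
  fixes f g :: "real \<Rightarrow> 'v :: euclidean_space"
  assumes f: "continuous_on {a..b} f" and g: "continuous_on {a..b} g" and fg: "aeq a b f g"
    and x: "x \<in> {a..b}"
  shows "f x = g x"
proof -
  let ?h = "\<lambda>x. norm (f x - g x)"
  obtain N where N: "negligible N" "\<forall>x\<in>{a..b} - N. f x = g x"
    using fg unfolding aeq_def ae_iff by auto
  then have "(?h has_integral 0) {a..b}"
    by (intro has_integral_negligible [of N]) auto
  then have "?h x = 0"
    using ab x by (intro has_integral_0_cbox_imp_0 [of a b ?h]) (auto intro!: continuous_intros f g)
  then show ?thesis
    by simp
qed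

text \<open>Asking for a primitive of \<open>g\<close> up to a null set, rather than for pointwise
  differentiability, makes the relation stable under a.e. changes of both functions. It is one link
  of a \<open>sob_chain\<close>.\<close>

definition weak_deriv :: "(real \<Rightarrow> 'v::euclidean_space) \<Rightarrow> (real \<Rightarrow> 'v) \<Rightarrow> bool" where
  "weak_deriv y g \<longleftrightarrow> Linf a b g \<and> (\<exists>c. aeq a b y (\<lambda>x. c + integral {a..x} g))"

lemma primitive_continuous: "Linf a b g \<Longrightarrow> continuous_on {a..b} (\<lambda>x. c + integral {a..x} g)"
  by (intro continuous_intros indefinite_integral_continuous_1 Linf_integrable)

lemma primitive_diff:
  "Linf a b g \<Longrightarrow> a \<le> s \<Longrightarrow> s \<le> t \<Longrightarrow> t \<le> b \<Longrightarrow> integral {a..t} g - integral {a..s} g = integral {s..t} g"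
  using Henstock_Kurzweil_Integration.integral_combine [where a = a and b = t and c = s and f = g]
    Linf_integrable_sub [of g a t] by (simp add: algebra_simps)

lemma weak_deriv_Linf: "weak_deriv y g \<Longrightarrow> Linf a b y"
  unfolding weak_deriv_def using Linf_aeq [OF Linf_continuous [OF primitive_continuous] aeq_sym] by blast

lemma weak_deriv_Linf': "weak_deriv y g \<Longrightarrow> Linf a b g"
  unfolding weak_deriv_def by simp

lemma weak_deriv_aeq:
  assumes "weak_deriv y g" "aeq a b y z" "aeq a b g h"
  shows "weak_deriv z h"
proof -
  obtain c where c: "aeq a b y (\<lambda>x. c + integral {a..x} g)" and g: "Linf a b g"
    using assms(1) unfolding weak_deriv_def by auto
  have "aeq a b (\<lambda>x. c + integral {a..x} g) (\<lambda>x. c + integral {a..x} h)"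
    unfolding aeq_def using integral_aeq [OF assms(3)] by (intro ae_I) auto
  then show ?thesis
    unfolding weak_deriv_def using Linf_aeq [OF g assms(3)] aeq_trans [OF aeq_sym [OF assms(2)] aeq_trans [OF c]] by auto
qed

text \<open>At \<open>a\<close> both primitives reduce to their constants, so these agree, and the
  difference of the two derivatives has a vanishing primitive.\<close>

lemma weak_deriv_unique:
  assumes y: "weak_deriv y g" and z: "weak_deriv y h"
  shows "aeq a b g h"
proof -
  obtain c d where c: "aeq a b y (\<lambda>x. c + integral {a..x} g)" and g: "Linf a b g"
    and d: "aeq a b y (\<lambda>x. d + integral {a..x} h)" and h: "Linf a b h"
    using y z unfolding weak_deriv_def by auto
  have eq: "c + integral {a..x} g = d + integral {a..x} h" if "x \<in> {a..b}" for x
    using continuous_ae_eq [OF primitive_continuous [OF g] primitive_continuous [OF h] aeq_trans [OF aeq_sym [OF c] d] that] .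
  have "c = d"
    using eq [of a] ab by simp
  have "ae (\<lambda>x. g x - h x = 0)"
  proof (rule integral_zero_imp_ae_zero)
    show "(\<lambda>x. g x - h x) integrable_on {a..b}"
      using g h by (intro integrable_diff Linf_integrable)
    show "integral {a..x} (\<lambda>x. g x - h x) = 0" if "x \<in> {a..b}" for x
    proof -
      have "integral {a..x} (\<lambda>x. g x - h x) = integral {a..x} g - integral {a..x} h"
        using that by (intro Henstock_Kurzweil_Integration.integral_diff Linf_integrable_sub g h) auto
      then show ?thesis
        using eq [OF that] \<open>c = d\<close> by simp
    qed
  qed
  then show ?thesis
    unfolding aeq_def by simp
qed

lemma weak_deriv_bounded_linear:
  assumes h: "bounded_linear h" and y: "weak_deriv y g"
  shows "weak_deriv (\<lambda>x. h (y x)) (\<lambda>x. h (g x))"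
proof -
  interpret bounded_linear h by fact
  obtain c where c: "aeq a b y (\<lambda>x. c + integral {a..x} g)" and g: "Linf a b g"
    using y unfolding weak_deriv_def by auto
  have prim: "integral {a..x} (\<lambda>x. h (g x)) = h (integral {a..x} g)" if "x \<in> {a..b}" for x
    using integral_linear [OF Linf_integrable_sub [OF g, of a x] h] that by (simp add: o_def)
  have "aeq a b (\<lambda>x. h (y x)) (\<lambda>x. h c + integral {a..x} (\<lambda>x. h (g x)))"
    using c ae_in unfolding aeq_def
    by eventually_elim (simp add: add prim)
  then show ?thesis
    unfolding weak_deriv_def using Linf_bounded_linear [OF h g] by auto
qed

lemma weak_deriv_add:
  assumes y: "weak_deriv y g" and z: "weak_deriv z h"
  shows "weak_deriv (\<lambda>x. y x + z x) (\<lambda>x. g x + h x)"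
proof -
  obtain c d where c: "aeq a b y (\<lambda>x. c + integral {a..x} g)" and g: "Linf a b g"
    and d: "aeq a b z (\<lambda>x. d + integral {a..x} h)" and h: "Linf a b h"
    using y z unfolding weak_deriv_def by auto
  have prim: "integral {a..x} (\<lambda>x. g x + h x) = integral {a..x} g + integral {a..x} h" if "x \<in> {a..b}" for x
    using that by (intro Henstock_Kurzweil_Integration.integral_add Linf_integrable_sub g h) auto
  have "aeq a b (\<lambda>x. y x + z x) (\<lambda>x. (c + d) + integral {a..x} (\<lambda>x. g x + h x))"
    using c d ae_in
    unfolding aeq_def by eventually_elim (simp add: prim add_ac)
  then show ?thesis
    unfolding weak_deriv_def using Linf_add [OF g h] by auto
qed

lemma weak_deriv_const: "weak_deriv (\<lambda>x. c) (\<lambda>x. 0)"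
  unfolding weak_deriv_def using Linf_continuous [of "\<lambda>x. 0"] by (auto intro!: exI [of _ c])

text \<open>
  This gives the product rule without differentiating almost everywhere: the difference between a
  product of two primitives and the primitive of its formal derivative has quadratic increments.
\<close>

lemma quadratic_increments_imp_constant:
  fixes f :: "real \<Rightarrow> 'v :: euclidean_space"
  assumes Q: "\<And>s t. a \<le> s \<Longrightarrow> s \<le> t \<Longrightarrow> t \<le> b \<Longrightarrow> norm (f t - f s) \<le> Q * (t - s)\<^sup>2"
    and x: "x \<in> {a..b}"
  shows "f x = f a"
proof -
  have "(f has_derivative (\<lambda>h. 0)) (at x within {a..b})" if x: "x \<in> {a..b}" for x
  proof (rule has_derivativeI_sandwich [of 1])
    show "((\<lambda>y. Q * \<bar>y - x\<bar>) \<longlongrightarrow> 0) (at x within {a..b})"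
      by (rule tendsto_eq_intros refl | simp)+
    show "norm (f y - f x - 0) / norm (y - x) \<le> Q * \<bar>y - x\<bar>" if y: "y \<in> {a..b}" "y \<noteq> x" for y
    proof -
      have "norm (f y - f x) \<le> Q * \<bar>y - x\<bar>\<^sup>2"
        using Q [of x y] Q [of y x] x y by (cases "x \<le> y") (auto simp: norm_minus_commute power2_commute)
      then show ?thesis
        using y by (simp add: field_simps power2_eq_square)
    qed
  qed auto
  then obtain c where "\<forall>x\<in>{a..b}. f x = c"
    using has_derivative_zero_constant [of "{a..b}" f] by auto
  then show ?thesis
    using x ab by simp
qed

lemma weak_deriv_bilinear:
  assumes h: "bounded_bilinear h" and y: "weak_deriv y g" and z: "weak_deriv z k"
  shows "weak_deriv (\<lambda>x. h (y x) (z x)) (\<lambda>x. h (g x) (z x) + h (y x) (k x))"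
proof -
  interpret h: bounded_bilinear h by fact
  obtain c d where c: "aeq a b y (\<lambda>x. c + integral {a..x} g)" and g: "Linf a b g"
    and d: "aeq a b z (\<lambda>x. d + integral {a..x} k)" and k: "Linf a b k"
    using y z unfolding weak_deriv_def by auto
  \<comment> \<open>The argument runs with the continuous representatives; the formal derivative
    \<open>p\<close> uses them in place of \<open>y\<close> and \<open>z\<close> and is exchanged at
    the end.\<close>
  define Y where "Y = (\<lambda>x. c + integral {a..x} g)"
  define Z where "Z = (\<lambda>x. d + integral {a..x} k)"
  have Y: "Linf a b Y" and Z: "Linf a b Z"
    unfolding Y_def Z_def by (rule Linf_continuous [OF primitive_continuous], fact)+
  define p where "p = (\<lambda>x. h (g x) (Z x) + h (Y x) (k x))"
  have p: "Linf a b p"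
    unfolding p_def by (intro Linf_add Linf_bounded_bilinear [OF h] g k Y Z)
  obtain K where K: "\<And>x y. norm (h x y) \<le> norm x * norm y * K" "0 \<le> K"
    using h.nonneg_bounded by auto
  obtain C0 where "ae (\<lambda>x. norm (g x) \<le> C0)" using Linf_bound [OF g] ..
  then have "ae (\<lambda>x. norm (g x) \<le> max C0 0)" by eventually_elim simp
  then obtain C where C: "ae (\<lambda>x. norm (g x) \<le> C)" "0 \<le> C" by (meson max.cobounded2)
  obtain D0 where "ae (\<lambda>x. norm (k x) \<le> D0)" using Linf_bound [OF k] ..
  then have "ae (\<lambda>x. norm (k x) \<le> max D0 0)" by eventually_elim simp
  then obtain D where D: "ae (\<lambda>x. norm (k x) \<le> D)" "0 \<le> D" by (meson max.cobounded2)
  have incr: "norm ((h (Y t) (Z t) - integral {a..t} p) - (h (Y s) (Z s) - integral {a..s} p)) \<le> 2 * C * D * K * (t - s)\<^sup>2"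
    if st: "a \<le> s" "s \<le> t" "t \<le> b" for s t
  proof -
    have sub: "{s..t} \<subseteq> {a..b}"
      using st by auto
    have dY: "Y r' - Y r = integral {r..r'} g" and dZ: "Z r' - Z r = integral {r..r'} k"
      if "a \<le> r" "r \<le> r'" "r' \<le> b" for r r'
      using primitive_diff [OF g that] primitive_diff [OF k that] by (simp_all add: Y_def Z_def)
    have nY: "norm (Y r' - Y r) \<le> C * (r' - r)" and nZ: "norm (Z r' - Z r) \<le> D * (r' - r)"
      if "a \<le> r" "r \<le> r'" "r' \<le> b" for r r'
      unfolding dY [OF that] dZ [OF that] using C(2) D(2) that
      by (auto intro!: norm_integral_ae_bound g k intro: eventually_mono [OF C(1)] eventually_mono [OF D(1)])
    \<comment> \<open>\<open>q\<close> is the change in \<open>p\<close> when \<open>Z r\<close> is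
      frozen at \<open>Z t\<close> and \<open>Y r\<close> at \<open>Y s\<close>. Each term contains
      an increment of order \<open>t - s\<close>, and integration over an interval of that length
      makes the error quadratic.\<close>
    define q where "q = (\<lambda>r. h (g r) (Z t - Z r) + h (Y s - Y r) (k r))"
    note Linf_minus = Linf_bounded_linear [OF bounded_linear_minus [OF bounded_linear_ident]]
    have c1: "Linf a b (\<lambda>r. Z t - Z r)" "Linf a b (\<lambda>r. Y s - Y r)"
      using Linf_add [OF Linf_continuous [of "\<lambda>_. Z t"] Linf_minus [OF Z]]
        Linf_add [OF Linf_continuous [of "\<lambda>_. Y s"] Linf_minus [OF Y]] by auto
    have q: "Linf a b q"
      unfolding q_def by (intro Linf_add Linf_bounded_bilinear [OF h] g k c1)
    have gt: "Linf a b (\<lambda>r. h (g r) (Z t))" and ks: "Linf a b (\<lambda>r. h (Y s) (k r))"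
      by (intro Linf_bounded_linear [OF h.bounded_linear_left] Linf_bounded_linear [OF h.bounded_linear_right] g k)+
    have "h (Y t) (Z t) - h (Y s) (Z s) = h (Y t - Y s) (Z t) + h (Y s) (Z t - Z s)"
      by (simp add: h.diff_left h.diff_right)
    also have "\<dots> = integral {s..t} (\<lambda>r. h (g r) (Z t)) + integral {s..t} (\<lambda>r. h (Y s) (k r))"
      using integral_linear [OF Linf_integrable_sub [OF g sub] h.bounded_linear_left, of "Z t"]
        integral_linear [OF Linf_integrable_sub [OF k sub] h.bounded_linear_right, of "Y s"]
      by (simp add: dY dZ st o_def)
    also have "\<dots> = integral {s..t} (\<lambda>r. h (g r) (Z t) + h (Y s) (k r))"
      using sub by (intro Henstock_Kurzweil_Integration.integral_add [symmetric] Linf_integrable_sub gt ks)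
    also have "(\<lambda>r. h (g r) (Z t) + h (Y s) (k r)) = (\<lambda>r. p r + q r)"
      by (simp add: p_def q_def h.diff_left h.diff_right fun_eq_iff)
    also have "integral {s..t} (\<lambda>r. p r + q r) = integral {s..t} p + integral {s..t} q"
      using sub by (intro Henstock_Kurzweil_Integration.integral_add Linf_integrable_sub p q)
    finally have eq: "(h (Y t) (Z t) - integral {a..t} p) - (h (Y s) (Z s) - integral {a..s} p) = integral {s..t} q"
      using primitive_diff [OF p st] by (simp add: algebra_simps)
    have "ae (\<lambda>r. r \<in> {s..t} \<longrightarrow> norm (q r) \<le> 2 * C * D * K * (t - s))"
      using C(1) D(1)
    proof eventually_elim
      case (elim r)
      show ?case
      proof
        assume r: "r \<in> {s..t}"
        have "norm (Z t - Z r) \<le> D * (t - s)"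
          using nZ [of r t] r st mult_left_mono [of "t - r" "t - s" D] D by auto
        then have "norm (g r) * norm (Z t - Z r) \<le> C * (D * (t - s))"
          using elim C by (intro mult_mono) auto
        then have 1: "norm (h (g r) (Z t - Z r)) \<le> C * (D * (t - s)) * K"
          by (meson K mult_right_mono order_trans)
        have "norm (Y s - Y r) \<le> C * (t - s)"
          using nY [of s r] r st mult_left_mono [of "r - s" "t - s" C] C by (auto simp: norm_minus_commute)
        then have "norm (Y s - Y r) * norm (k r) \<le> C * (t - s) * D"
          using elim C st by (intro mult_mono) auto
        then have 2: "norm (h (Y s - Y r) (k r)) \<le> C * (t - s) * D * K"
          by (meson K mult_right_mono order_trans)
        have "norm (q r) \<le> C * (D * (t - s)) * K + C * (t - s) * D * K"
          unfolding q_def using 1 2 by (rule norm_triangle_mono)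
        then show "norm (q r) \<le> 2 * C * D * K * (t - s)"
          by (simp add: algebra_simps)
      qed
    qed
    then have "norm (integral {s..t} q) \<le> 2 * C * D * K * (t - s) * (t - s)"
      using C D K st by (intro norm_integral_ae_bound q) auto
    then show ?thesis
      unfolding eq by (simp add: power2_eq_square mult.assoc)
  qed
  have prim: "h (Y x) (Z x) = h c d + integral {a..x} p" if "x \<in> {a..b}" for x
    using quadratic_increments_imp_constant [OF incr that] by (simp add: Y_def Z_def algebra_simps)
  have "ae (\<lambda>x. h (y x) (z x) = h c d + integral {a..x} p)"
    using c d ae_in unfolding aeq_def
    by eventually_elim (metis Y_def Z_def prim)
  then have "weak_deriv (\<lambda>x. h (y x) (z x)) p"
    unfolding weak_deriv_def aeq_def using p by auto
  moreover have "aeq a b p (\<lambda>x. h (g x) (z x) + h (y x) (k x))"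
    using c d unfolding aeq_def by eventually_elim (simp add: Y_def Z_def p_def)
  ultimately show ?thesis
    using weak_deriv_aeq aeq_refl by blast
qed

subsection \<open>Sobolev norms\<close>

text \<open>The values of \<open>esssup\<close> are extended reals and \<open>real_of_ereal\<close>
  sends infinite ones to 0, so finiteness has to be settled before the real number means
  anything.\<close>

lemma esssup_component:
  assumes "Linf a b (g :: real \<Rightarrow> complex ^ 'm)"
  defines "e \<equiv> \<lambda>i. esssup (lebesgue_on {a..b}) (\<lambda>x. ereal (cmod (g x $ i)))"
  shows "0 \<le> real_of_ereal (e i)" "ae (\<lambda>x. cmod (g x $ i) \<le> real_of_ereal (e i))"
    and "ae (\<lambda>x. cmod (g x $ i) \<le> C) \<Longrightarrow> real_of_ereal (e i) \<le> C"
proof -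
  have [measurable]: "(\<lambda>x. g x $ i) \<in> borel_measurable (lebesgue_on {a..b})"
    by (rule borel_measurable_continuous_on [OF _ Linf_measurable [OF assms(1)]]) (intro continuous_intros)
  have le: "e i \<le> ereal C" if "ae (\<lambda>x. cmod (g x $ i) \<le> C)" for C
    unfolding e_def using that by (intro esssup_I) auto
  have e: "ae (\<lambda>x. ereal (cmod (g x $ i)) \<le> e i)"
    unfolding e_def by (rule esssup_AE)
  \<comment> \<open>The interval has positive length, so the bound holds at some point; this rules
    out the value minus infinity.\<close>
  then obtain x where "ereal (cmod (g x $ i)) \<le> e i"
    using ae_ex by blast
  then have "0 \<le> e i"
    by (metis ereal_less_eq(5) norm_ge_zero order_trans zero_ereal_def)
  moreover obtain D where "ae (\<lambda>x. norm (g x) \<le> D)"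
    using Linf_bound [OF assms(1)] ..
  then have "ae (\<lambda>x. cmod (g x $ i) \<le> D)"
    by eventually_elim (meson Finite_Cartesian_Product.norm_nth_le order_trans)
  then have "e i \<le> ereal D"
    by (rule le)
  ultimately have fin: "ereal (real_of_ereal (e i)) = e i"
    by (cases "e i") auto
  show "0 \<le> real_of_ereal (e i)"
    using \<open>0 \<le> e i\<close> fin by (simp add: real_of_ereal_pos)
  show "ae (\<lambda>x. cmod (g x $ i) \<le> real_of_ereal (e i))"
    using e by (subst (asm) fin [symmetric]) simp
  show "real_of_ereal (e i) \<le> C" if "ae (\<lambda>x. cmod (g x $ i) \<le> C)"
    using le [OF that] by (subst (asm) fin [symmetric]) simp
qed

lemma linf_norm_nonneg: "Linf a b g \<Longrightarrow> 0 \<le> linf_norm a b g"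
  unfolding linf_norm_def by (intro sum_nonneg esssup_component(1))

lemma linf_norm_ae:
  assumes "Linf a b g"
  shows "ae (\<lambda>x. norm (g x) \<le> linf_norm a b g)"
proof -
  let ?e = "\<lambda>i. real_of_ereal (esssup (lebesgue_on {a..b}) (\<lambda>x. ereal (cmod (g x $ i))))"
  have "ae (\<lambda>x. \<forall>i\<in>UNIV. cmod (g x $ i) \<le> ?e i)"
    by (intro AE_finite_allI esssup_component(2) assms) simp
  then show ?thesis
  proof eventually_elim
    case (elim x)
    have "norm (g x) \<le> (\<Sum>i\<in>UNIV. cmod (g x $ i))"
      unfolding norm_vec_def by (rule L2_set_le_sum) simp
    also have "\<dots> \<le> linf_norm a b g"
      unfolding linf_norm_def using elim by (intro sum_mono) auto
    finally show ?case .
  qed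
qed

text \<open>Each component is at most the Euclidean norm; summing the suprema of the components
  costs the factor \<open>CARD('m)\<close>.\<close>

lemma linf_norm_le:
  fixes g :: "real \<Rightarrow> complex ^ 'm" and C :: real
  assumes "Linf a b g" "ae (\<lambda>x. norm (g x) \<le> C)"
  shows "linf_norm a b g \<le> CARD('m) * C"
proof -
  have "ae (\<lambda>x. cmod (g x $ i) \<le> C)" for i
    using assms(2) by eventually_elim (meson Finite_Cartesian_Product.norm_nth_le order_trans)
  then have "linf_norm a b g \<le> (\<Sum>i\<in>(UNIV :: 'm set). C)"
    unfolding linf_norm_def by (intro sum_mono esssup_component(3) [OF assms(1)])
  then show ?thesis
    by simp
qed

lemma linf_norm_aeq: "aeq a b f g \<Longrightarrow> Linf a b f \<Longrightarrow> linf_norm a b f = linf_norm a b g"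
proof -
  have le: "linf_norm a b f \<le> linf_norm a b g" if fg: "aeq a b f g" and f: "Linf a b f" for f g :: "real \<Rightarrow> complex ^ 'm"
    unfolding linf_norm_def
  proof (intro sum_mono esssup_component(3) [OF f])
    show "ae (\<lambda>x. cmod (f x $ i) \<le> real_of_ereal (esssup (lebesgue_on {a..b}) (\<lambda>x. ereal (cmod (g x $ i)))))" for i
      using esssup_component(2) [OF Linf_aeq [OF f fg], of i] fg unfolding aeq_def by eventually_elim simp
  qed
  assume "aeq a b f g" "Linf a b f"
  then show ?thesis
    using le [of f g] le [of g f] Linf_aeq aeq_sym by fastforce
qed

lemma Linf_smult_add: "Linf a b f \<Longrightarrow> Linf a b g \<Longrightarrow> Linf a b (\<lambda>x. c *s f x + g x :: complex ^ 'm)"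
  by (intro Linf_add Linf_bounded_linear [OF bounded_linear_smult])

lemma linf_norm_smult_add:
  assumes f: "Linf a b f" and g: "Linf a b g"
  shows "linf_norm a b (\<lambda>x. c *s f x + g x) \<le> cmod c * linf_norm a b f + linf_norm a b g"
  unfolding linf_norm_def sum_distrib_left sum.distrib [symmetric]
proof (intro sum_mono esssup_component(3) [OF Linf_smult_add [OF f g]])
  let ?e = "\<lambda>g i. real_of_ereal (esssup (lebesgue_on {a..b}) (\<lambda>x. ereal (cmod (g x $ i))))"
  show "ae (\<lambda>x. cmod ((c *s f x + g x) $ i) \<le> cmod c * ?e f i + ?e g i)" for i
    using esssup_component(2) [OF f, of i] esssup_component(2) [OF g, of i]
  proof eventually_elim
    case (elim x)
    then show ?case
      using mult_left_mono [OF elim(1), of "cmod c"]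
      by (auto intro!: norm_triangle_mono simp: norm_mult)
  qed
qed

lemma sob_chain_aeq: "aeq a b y z \<Longrightarrow> sob_chain a b k y G \<longleftrightarrow> sob_chain a b k z G"
  unfolding sob_chain_def using aeq_trans aeq_sym by blast

lemma Wk_aeq: "aeq a b y z \<Longrightarrow> Wk a b k y \<longleftrightarrow> Wk a b k z"
  unfolding Wk_def using sob_chain_aeq by blast

lemma wnorm_aeq: "aeq a b y z \<Longrightarrow> wnorm a b k y = wnorm a b k z"
  unfolding wnorm_def using sob_chain_aeq [of y z] by simp

lemma sob_chain_head: "sob_chain a b k y G \<Longrightarrow> aeq a b y (G 0)" "sob_chain a b k y G \<Longrightarrow> Linf a b (G 0)"
  unfolding sob_chain_def by blast+

lemma sob_chain_mono: "l \<le> k \<Longrightarrow> sob_chain a b k y G \<Longrightarrow> sob_chain a b l y G"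
  unfolding sob_chain_def by (meson le_trans less_le_trans)

lemma sob_chain_0: "sob_chain a b 0 y G \<longleftrightarrow> Linf a b y \<and> aeq a b y (G 0)"
  unfolding sob_chain_def using Linf_aeq aeq_sym by fastforce

lemma Wk_0: "Wk a b 0 y \<longleftrightarrow> Linf a b y"
proof
  assume "Linf a b y"
  then have "sob_chain a b 0 y (\<lambda>_. y)"
    by (simp add: sob_chain_0)
  then show "Wk a b 0 y"
    unfolding Wk_def by blast
qed (auto simp: Wk_def sob_chain_0)

lemma sob_chain_SucD:
  assumes "sob_chain a b (Suc k) y G"
  shows "weak_deriv y (G 1)" "sob_chain a b k (G 1) (\<lambda>j. G (Suc j))"
proof -
  have G: "\<And>j. j \<le> Suc k \<Longrightarrow> Linf a b (G j)" "aeq a b y (G 0)"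
    "\<And>j x. j < Suc k \<Longrightarrow> x \<in> {a..b} \<Longrightarrow> G j x = G j a + integral {a..x} (G (Suc j))"
    using assms unfolding sob_chain_def by blast+
  have "aeq a b (G 0) (\<lambda>x. G 0 a + integral {a..x} (G 1))"
    unfolding aeq_def One_nat_def by (intro ae_I G(3)) simp_all
  then show "weak_deriv y (G 1)"
    unfolding weak_deriv_def using G(1) [of 1] aeq_trans [OF G(2)] by auto
  show "sob_chain a b k (G 1) (\<lambda>j. G (Suc j))"
    using assms unfolding sob_chain_def by (metis Suc_le_mono Suc_less_eq One_nat_def aeq_refl)
qed

text \<open>The continuous primitive goes in front of the chain, since \<open>y\<close> itself is
  determined only almost everywhere. The shift equation records that the rest of the chain is
  unchanged, as the recursion for the norm requires.\<close>

lemma sob_chain_SucI: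
  assumes y: "weak_deriv y g" and H: "sob_chain a b k g H"
  shows "\<exists>G. sob_chain a b (Suc k) y G \<and> (\<lambda>j. G (Suc j)) = H"
proof -
  have gH: "aeq a b g (H 0)" and HL: "\<And>j. j \<le> k \<Longrightarrow> Linf a b (H j)"
    and HI: "\<And>j. j < k \<Longrightarrow> H (Suc j) integrable_on {a..b}"
    and HE: "\<And>j x. j < k \<Longrightarrow> x \<in> {a..b} \<Longrightarrow> H j x = H j a + integral {a..x} (H (Suc j))"
    using H unfolding sob_chain_def by blast+
  have H0: "Linf a b (H 0)"
    by (rule HL) simp
  have "weak_deriv y (H 0)"
    using weak_deriv_aeq [OF y aeq_refl gH] by simp
  then obtain c where c: "aeq a b y (\<lambda>x. c + integral {a..x} (H 0))"
    unfolding weak_deriv_def by auto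
  define G where "G = case_nat (\<lambda>x. c + integral {a..x} (H 0)) H"
  have "sob_chain a b (Suc k) y G"
    unfolding sob_chain_def
  proof (intro conjI allI impI ballI)
    show "Linf a b (G j)" if "j \<le> Suc k" for j
      using that HL Linf_continuous [OF primitive_continuous [OF H0]] by (cases j) (auto simp: G_def)
    show "G (Suc j) integrable_on {a..b}" if "j < Suc k" for j
      using that HI Linf_integrable [OF H0] by (cases j) (auto simp: G_def)
    show "G j x = G j a + integral {a..x} (G (Suc j))" if "j < Suc k" "x \<in> {a..b}" for j x
      using that HE by (cases j) (simp_all only: G_def nat.case Suc_less_eq, simp)
  qed (use c in \<open>simp add: G_def\<close>)
  then show ?thesis
    by (intro exI [of _ G]) (simp add: G_def)
qed

text \<open>With \<open>wnorm_Suc\<close>, this is the recursion that carries the later inductions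
  on the order \<open>k\<close>.\<close>

lemma Wk_Suc: "Wk a b (Suc k) y \<longleftrightarrow> (\<exists>g. weak_deriv y g \<and> Wk a b k g)"
  unfolding Wk_def using sob_chain_SucD sob_chain_SucI by meson

lemma Wk_Suc_deriv: "Wk a b (Suc k) y \<Longrightarrow> weak_deriv y g \<Longrightarrow> Wk a b k g"
  using Wk_Suc weak_deriv_unique Wk_aeq by metis

lemma Wk_Linf: "Wk a b k y \<Longrightarrow> Linf a b y"
  by (cases k) (auto simp: Wk_0 Wk_Suc weak_deriv_Linf)

text \<open>Weak derivatives are unique almost everywhere, level by level, so the set whose infimum
  defines \<open>wnorm\<close> has just one element.\<close>

lemma sob_chain_sum_unique:
  "sob_chain a b k y G \<Longrightarrow> sob_chain a b k y H \<Longrightarrow>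
    (\<Sum>j\<le>k. linf_norm a b (G j)) = (\<Sum>j\<le>k. linf_norm a b (H j))"
proof (induction k arbitrary: y G H)
  case 0
  have "aeq a b (G 0) (H 0)" "Linf a b (G 0)"
    by (rule aeq_trans [OF aeq_sym [OF sob_chain_head(1) [OF 0(1)]] sob_chain_head(1) [OF 0(2)]],
      rule sob_chain_head(2) [OF 0(1)])
  then show ?case
    using linf_norm_aeq [of "G 0" "H 0"] by simp
next
  case (Suc k)
  have "aeq a b (G 0) (H 0)" "Linf a b (G 0)"
    by (rule aeq_trans [OF aeq_sym [OF sob_chain_head(1) [OF Suc.prems(1)]] sob_chain_head(1) [OF Suc.prems(2)]],
      rule sob_chain_head(2) [OF Suc.prems(1)])
  moreover have "aeq a b (G 1) (H 1)"
    by (rule weak_deriv_unique [OF sob_chain_SucD(1) [OF Suc.prems(1)] sob_chain_SucD(1) [OF Suc.prems(2)]])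
  then have "(\<Sum>j\<le>k. linf_norm a b (G (Suc j))) = (\<Sum>j\<le>k. linf_norm a b (H (Suc j)))"
    using Suc.IH [OF sob_chain_SucD(2) [OF Suc.prems(1)]] sob_chain_SucD(2) [OF Suc.prems(2)] sob_chain_aeq by blast
  ultimately show ?case
    using linf_norm_aeq [of "G 0" "H 0"] by (simp del: sum.atMost_Suc add: sum.atMost_Suc_shift)
qed

lemma wnorm_sob_chain:
  assumes "sob_chain a b k y G"
  shows "wnorm a b k y = (\<Sum>j\<le>k. linf_norm a b (G j))"
proof -
  have "{(\<Sum>j\<le>k. linf_norm a b (G j)) | G. sob_chain a b k y G} = {\<Sum>j\<le>k. linf_norm a b (G j)}"
    using assms sob_chain_sum_unique by blast
  then show ?thesis
    unfolding wnorm_def by simp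
qed

lemma wnorm_0: "Linf a b y \<Longrightarrow> wnorm a b 0 y = linf_norm a b y"
  using wnorm_sob_chain [of 0 y "\<lambda>_. y"] by (simp add: sob_chain_0)

lemma wnorm_Suc:
  assumes y: "weak_deriv y g" and g: "Wk a b k g"
  shows "wnorm a b (Suc k) y = linf_norm a b y + wnorm a b k g"
proof -
  obtain H where H: "sob_chain a b k g H"
    using g Wk_def by metis
  obtain G where G: "sob_chain a b (Suc k) y G" "(\<lambda>j. G (Suc j)) = H"
    using sob_chain_SucI [OF y H] by auto
  have "linf_norm a b (G 0) = linf_norm a b y"
    using linf_norm_aeq [OF aeq_sym [OF sob_chain_head(1)]] sob_chain_head(2) G(1) by blast
  then show ?thesis
    unfolding wnorm_sob_chain [OF G(1)] wnorm_sob_chain [OF H] G(2) [symmetric]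
    by (simp del: sum.atMost_Suc add: sum.atMost_Suc_shift)
qed

text \<open>\<open>wderiv\<close> selects a chain of order 1 by choice; truncating a longer chain
  shows that one exists.\<close>

lemma weak_deriv_wderiv:
  assumes "Wk a b (Suc k) y"
  shows "weak_deriv y (wderiv a b y)"
proof -
  obtain G where G: "sob_chain a b (Suc k) y G"
    using assms Wk_def by metis
  have "sob_chain a b 1 y G"
    by (rule sob_chain_mono [OF _ G]) simp
  then have "sob_chain a b 1 y (SOME G. sob_chain a b 1 y G)"
    by (rule someI [of "sob_chain a b 1 y"])
  then show ?thesis
    unfolding wderiv_def using sob_chain_SucD(1) [of 0] by simp
qed

lemma weak_deriv_smult_add:
  "weak_deriv y g \<Longrightarrow> weak_deriv z h \<Longrightarrow> weak_deriv (\<lambda>x. c *s y x + z x :: complex ^ 'm) (\<lambda>x. c *s g x + h x)"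
  by (intro weak_deriv_add weak_deriv_bounded_linear [OF bounded_linear_smult])

text \<open>Closure and the norm estimate share one induction. The choices \<open>c = 1\<close>,
  \<open>c = -1\<close> and \<open>z = 0\<close> then give sums, differences and multiples.\<close>

lemma Wk_smult_add:
  fixes y z :: "real \<Rightarrow> complex ^ 'm"
  shows "Wk a b k y \<Longrightarrow> Wk a b k z \<Longrightarrow>
    Wk a b k (\<lambda>x. c *s y x + z x) \<and> wnorm a b k (\<lambda>x. c *s y x + z x) \<le> cmod c * wnorm a b k y + wnorm a b k z"
proof (induction k arbitrary: y z)
  case 0
  then show ?case
    using linf_norm_smult_add by (simp add: Wk_0 wnorm_0 Linf_smult_add)
next
  case (Suc k)
  then obtain g h where g: "weak_deriv y g" "Wk a b k g" and h: "weak_deriv z h" "Wk a b k h"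
    using Wk_Suc by meson
  note d = weak_deriv_smult_add [OF g(1) h(1), of c]
  have IH: "Wk a b k (\<lambda>x. c *s g x + h x)"
    "wnorm a b k (\<lambda>x. c *s g x + h x) \<le> cmod c * wnorm a b k g + wnorm a b k h"
    using Suc.IH g h by auto
  have "Wk a b (Suc k) (\<lambda>x. c *s y x + z x)"
    using d IH(1) Wk_Suc by blast
  moreover have "wnorm a b (Suc k) (\<lambda>x. c *s y x + z x) \<le> cmod c * wnorm a b (Suc k) y + wnorm a b (Suc k) z"
    unfolding wnorm_Suc [OF d IH(1)] wnorm_Suc [OF g] wnorm_Suc [OF h]
    using IH(2) linf_norm_smult_add [OF Wk_Linf [OF Suc.prems(1)] Wk_Linf [OF Suc.prems(2)], of c]
    by (simp add: algebra_simps)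
  ultimately show ?case ..
qed

lemma Wk_Suc_imp:
  fixes y :: "real \<Rightarrow> 'v :: euclidean_space"
  shows "Wk a b (Suc k) y \<Longrightarrow> Wk a b k y"
proof (induction k arbitrary: y)
  case (Suc k)
  then show ?case
    using Wk_Suc by metis
qed (auto simp: Wk_0 Wk_Linf)

lemma wnorm_nonneg: "Wk a b k y \<Longrightarrow> 0 \<le> wnorm a b k y"
proof -
  assume "Wk a b k y"
  then obtain G where G: "sob_chain a b k y G"
    using Wk_def by metis
  then show ?thesis
    unfolding wnorm_sob_chain [OF G] by (intro sum_nonneg linf_norm_nonneg) (auto simp: sob_chain_def)
qed

lemma linf_norm_le_wnorm: "Wk a b k y \<Longrightarrow> linf_norm a b y \<le> wnorm a b k y"
  by (cases k) (auto simp: Wk_0 Wk_Suc wnorm_0 wnorm_Suc wnorm_nonneg)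

lemma wnorm_le_Suc: "Wk a b (Suc k) y \<Longrightarrow> wnorm a b k y \<le> wnorm a b (Suc k) y"
proof (induction k arbitrary: y)
  case 0
  then show ?case
    using linf_norm_le_wnorm [of "Suc 0" y] by (simp add: wnorm_0 Wk_Linf)
next
  case (Suc k)
  then obtain g where g: "weak_deriv y g" "Wk a b (Suc k) g"
    using Wk_Suc by meson
  then show ?case
    using Suc.IH [OF g(2)] wnorm_Suc [OF g(1)] Wk_Suc_imp by fastforce
qed

lemma wnorm_wderiv_le:
  assumes "Wk a b (Suc k) y"
  shows "Wk a b k (wderiv a b y)" "wnorm a b k (wderiv a b y) \<le> wnorm a b (Suc k) y"
proof -
  show *: "Wk a b k (wderiv a b y)"
    using assms weak_deriv_wderiv Wk_Suc_deriv by blast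
  show "wnorm a b k (wderiv a b y) \<le> wnorm a b (Suc k) y"
    using wnorm_Suc [OF weak_deriv_wderiv [OF assms] *] linf_norm_nonneg [OF Wk_Linf [OF assms]] by simp
qed

lemma Wk_bounded_linear:
  assumes "bounded_linear h"
  shows "Wk a b k y \<Longrightarrow> Wk a b k (\<lambda>x. h (y x))"
proof (induction k arbitrary: y)
  case (Suc k)
  then show ?case
    using Wk_Suc weak_deriv_bounded_linear [OF assms] by metis
qed (simp add: Wk_0 Linf_bounded_linear [OF assms])

lemma Wk_const: "Wk a b k (\<lambda>x. c)"
proof (induction k arbitrary: c)
  case (Suc k)
  then show ?case
    using Wk_Suc weak_deriv_const by metis
qed (simp add: Wk_0 Linf_continuous)

lemma wnorm_eq_0_imp:
  assumes "Wk a b k y" "wnorm a b k y \<le> 0"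
  shows "aeq a b y (\<lambda>x. 0)"
  using linf_norm_ae [OF Wk_Linf [OF assms(1)]] unfolding aeq_def
proof eventually_elim
  case (elim x)
  then have "norm (y x) \<le> 0"
    using linf_norm_le_wnorm [OF assms(1)] assms(2) by linarith
  then show ?case
    by simp
qed

lemma wnorm_zero: "wnorm a b k (\<lambda>x. 0 :: complex ^ 'm) = 0"
proof (induction k)
  have "linf_norm a b (\<lambda>x. 0 :: complex ^ 'm) \<le> real CARD('m) * 0"
    by (intro linf_norm_le Linf_continuous ae_I) auto
  then have *: "linf_norm a b (\<lambda>x. 0 :: complex ^ 'm) = 0"
    using linf_norm_nonneg [of "\<lambda>x. 0 :: complex ^ 'm"] Linf_continuous [of "\<lambda>x. 0 :: complex ^ 'm"] by auto
  case 0
  show ?case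
    using * by (simp add: wnorm_0 Linf_continuous)
  case (Suc k)
  then show ?case
    using * by (simp add: wnorm_Suc [OF weak_deriv_const Wk_const])
qed

lemma Wk_add: "Wk a b k y \<Longrightarrow> Wk a b k z \<Longrightarrow> Wk a b k (\<lambda>x. y x + z x :: complex ^ 'm)"
  using Wk_smult_add [of k y z 1] by simp

lemma wnorm_add_le:
  "Wk a b k y \<Longrightarrow> Wk a b k z \<Longrightarrow> wnorm a b k (\<lambda>x. y x + z x :: complex ^ 'm) \<le> wnorm a b k y + wnorm a b k z"
  using Wk_smult_add [of k y z 1] by simp

lemma Wk_smult: "Wk a b k y \<Longrightarrow> Wk a b k (\<lambda>x. c *s y x :: complex ^ 'm)"
  using Wk_smult_add [of k y "\<lambda>x. 0" c] by (simp add: Wk_const)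

lemma wnorm_smult_le: "Wk a b k y \<Longrightarrow> wnorm a b k (\<lambda>x. c *s y x :: complex ^ 'm) \<le> cmod c * wnorm a b k y"
  using Wk_smult_add [of k y "\<lambda>x. 0" c] by (simp add: Wk_const wnorm_zero)

lemma Wk_diff: "Wk a b k y \<Longrightarrow> Wk a b k z \<Longrightarrow> Wk a b k (\<lambda>x. y x - z x :: complex ^ 'm)"
  using Wk_smult_add [of k z y "-1"] by simp

lemma wnorm_diff_le:
  "Wk a b k y \<Longrightarrow> Wk a b k z \<Longrightarrow> wnorm a b k (\<lambda>x. y x - z x :: complex ^ 'm) \<le> wnorm a b k y + wnorm a b k z"
  using Wk_smult_add [of k z y "-1"] by simp

lemma wnorm_minus:
  assumes "Wk a b k y"
  shows "wnorm a b k (\<lambda>x. - y x :: complex ^ 'm) = wnorm a b k y"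
proof (rule antisym)
  show "wnorm a b k (\<lambda>x. - y x) \<le> wnorm a b k y"
    using wnorm_smult_le [OF assms, of "-1"] by simp
  show "wnorm a b k y \<le> wnorm a b k (\<lambda>x. - y x)"
    using wnorm_smult_le [OF Wk_smult [OF assms, of "-1"], of "-1"] by simp
qed

lemma wnorm_minus_commute:
  "Wk a b k y \<Longrightarrow> Wk a b k z \<Longrightarrow> wnorm a b k (\<lambda>x. y x - z x :: complex ^ 'm) = wnorm a b k (\<lambda>x. z x - y x)"
  using wnorm_minus [OF Wk_diff, of k z y] by simp

lemma wnorm_triangle:
  assumes "Wk a b k y" "Wk a b k z" "Wk a b k w"
  shows "wnorm a b k (\<lambda>x. y x - w x :: complex ^ 'm) \<le> wnorm a b k (\<lambda>x. y x - z x) + wnorm a b k (\<lambda>x. z x - w x)"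
  using wnorm_add_le [OF Wk_diff [OF assms(1,2)] Wk_diff [OF assms(2,3)]] by simp

lemma Wk_sum:
  assumes "finite I" "\<And>i. i \<in> I \<Longrightarrow> Wk a b k (f i)"
  shows "Wk a b k (\<lambda>x. \<Sum>i\<in>I. f i x :: complex ^ 'm)"
    and "wnorm a b k (\<lambda>x. \<Sum>i\<in>I. f i x) \<le> (\<Sum>i\<in>I. wnorm a b k (f i))"
  using assms
proof (induction I rule: finite_induct)
  case empty
  { case 1 show ?case by (simp add: Wk_const) }
  { case 2 show ?case by (simp add: wnorm_zero) }
next
  case (insert i I)
  { case 1 show ?case
      using insert.IH(1) insert.hyps 1 by (simp add: Wk_add) }
  { case 2 show ?case
      using insert.IH insert.hyps 2 wnorm_add_le [of k "f i" "\<lambda>x. \<Sum>i\<in>I. f i x"] by simp }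
qed

subsection \<open>Multiplication and completeness\<close>

text \<open>The Leibniz rule turns the derivative of the product into two products of order
  \<open>k\<close>, both covered by the induction hypothesis. The constant is uniform in the
  functions and the index.\<close>

lemma Wk_component_smult:
  "\<exists>C\<ge>0. \<forall>(w :: real \<Rightarrow> complex ^ 'm) v :: real \<Rightarrow> complex ^ 'm. \<forall>i. Wk a b k w \<longrightarrow> Wk a b k v \<longrightarrow>
     Wk a b k (\<lambda>x. w x $ i *s v x) \<and> wnorm a b k (\<lambda>x. w x $ i *s v x) \<le> C * wnorm a b k w * wnorm a b k v"
proof (induction k)
  have linf: "linf_norm a b (\<lambda>x. w x $ i *s v x) \<le> CARD('m) * linf_norm a b w * linf_norm a b v"
    if w: "Linf a b w" and v: "Linf a b v" for w v :: "real \<Rightarrow> complex ^ 'm" and i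
  proof -
    have "ae (\<lambda>x. norm (w x $ i *s v x) \<le> linf_norm a b w * linf_norm a b v)"
      using linf_norm_ae [OF w] linf_norm_ae [OF v]
    proof eventually_elim
      case (elim x)
      have "cmod (w x $ i) \<le> linf_norm a b w"
        using elim(1) by (meson Finite_Cartesian_Product.norm_nth_le order_trans)
      then show ?case
        unfolding norm_vector_smult using elim linf_norm_nonneg [OF w] by (intro mult_mono) auto
    qed
    then show ?thesis
      using linf_norm_le [OF Linf_bounded_bilinear [OF bounded_bilinear_component_smult w v, of i]]
      by (simp add: mult.assoc)
  qed
  case 0
  show ?case
  proof (intro exI [of _ "real CARD('m)"] conjI allI impI)
    fix w v :: "real \<Rightarrow> complex ^ 'm" and i
    assume "Wk a b 0 w" "Wk a b 0 v"
    then have w: "Linf a b w" and v: "Linf a b v"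
      by (simp_all add: Wk_0)
    note wv = Linf_bounded_bilinear [OF bounded_bilinear_component_smult w v, of i]
    show "Wk a b 0 (\<lambda>x. w x $ i *s v x)"
      using wv by (simp add: Wk_0)
    show "wnorm a b 0 (\<lambda>x. w x $ i *s v x) \<le> real CARD('m) * wnorm a b 0 w * wnorm a b 0 v"
      using linf [OF w v, of i] by (simp only: wnorm_0 [OF wv] wnorm_0 [OF w] wnorm_0 [OF v])
  qed simp
  case (Suc k)
  obtain C where "C \<ge> 0" and C0: "\<forall>(w :: real \<Rightarrow> complex ^ 'm) v :: real \<Rightarrow> complex ^ 'm. \<forall>i. Wk a b k w \<longrightarrow> Wk a b k v \<longrightarrow>
     Wk a b k (\<lambda>x. w x $ i *s v x) \<and> wnorm a b k (\<lambda>x. w x $ i *s v x) \<le> C * wnorm a b k w * wnorm a b k v"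
    using Suc.IH by blast
  note C = C0 [rule_format, THEN conjunct1] C0 [rule_format, THEN conjunct2]
  show ?case
  \<comment> \<open>\<open>CARD('m)\<close> pays for the product itself and \<open>C\<close> for
    each of the two Leibniz terms.\<close>
  proof (intro exI [of _ "CARD('m) + 2 * C"] conjI allI impI)
    fix w v :: "real \<Rightarrow> complex ^ 'm" and i
    assume w: "Wk a b (Suc k) w" and v: "Wk a b (Suc k) v"
    let ?W = "wnorm a b (Suc k) w" and ?V = "wnorm a b (Suc k) v"
    obtain g h where g: "weak_deriv w g" "Wk a b k g" and h: "weak_deriv v h" "Wk a b k h"
      using w v Wk_Suc by meson
    note d = weak_deriv_bilinear [OF bounded_bilinear_component_smult g(1) h(1), of i]
    note w' = Wk_Suc_imp [OF w] and v' = Wk_Suc_imp [OF v]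
    have Wd: "Wk a b k (\<lambda>x. g x $ i *s v x + w x $ i *s h x)"
      by (intro Wk_add C g(2) h(2) w' v')
    then show "Wk a b (Suc k) (\<lambda>x. w x $ i *s v x)"
      using d Wk_Suc by blast
    have nonneg: "0 \<le> linf_norm a b w" "0 \<le> linf_norm a b v" "0 \<le> wnorm a b k g" "0 \<le> wnorm a b k h"
      using g h linf_norm_nonneg [OF Wk_Linf [OF w]] linf_norm_nonneg [OF Wk_Linf [OF v]] by (auto intro: wnorm_nonneg)
    have bd: "linf_norm a b w \<le> ?W" "linf_norm a b v \<le> ?V" "wnorm a b k g \<le> ?W" "wnorm a b k h \<le> ?V"
      "wnorm a b k w \<le> ?W" "wnorm a b k v \<le> ?V"
      using nonneg wnorm_Suc [OF g] wnorm_Suc [OF h] wnorm_le_Suc [OF w] wnorm_le_Suc [OF v] by auto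
    have WV: "0 \<le> ?W" "0 \<le> ?V" "0 \<le> wnorm a b k w" "0 \<le> wnorm a b k v"
      using w v w' v' by (auto intro: wnorm_nonneg)
    have 1: "linf_norm a b (\<lambda>x. w x $ i *s v x) \<le> CARD('m) * (?W * ?V)"
      using linf [OF Wk_Linf [OF w] Wk_Linf [OF v], of i] mult_mono [OF bd(1,2)] nonneg WV
      by (smt (verit) mult.assoc mult_left_mono of_nat_0_le_iff)
    have 2: "wnorm a b k (\<lambda>x. g x $ i *s v x) \<le> C * (?W * ?V)"
      using C(2) [OF g(2) v', of i] mult_mono [OF bd(3,6)] nonneg WV \<open>C \<ge> 0\<close>
      by (smt (verit) mult.assoc mult_left_mono)
    have 3: "wnorm a b k (\<lambda>x. w x $ i *s h x) \<le> C * (?W * ?V)"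
      using C(2) [OF w' h(2), of i] mult_mono [OF bd(5,4)] nonneg WV \<open>C \<ge> 0\<close>
      by (smt (verit) mult.assoc mult_left_mono)
    show "wnorm a b (Suc k) (\<lambda>x. w x $ i *s v x) \<le> (CARD('m) + 2 * C) * ?W * ?V"
      unfolding wnorm_Suc [OF d Wd]
      using 1 2 3 wnorm_add_le [OF C(1) [OF g(2) v', of i] C(1) [OF w' h(2), of i]]
      by (simp add: algebra_simps)
  qed (use \<open>C \<ge> 0\<close> in simp)
qed

text \<open>Columns are the convenient unit: \<open>A x *v y x\<close> combines them with the
  components of \<open>y\<close>, and a difference of two operators applied to a constant basis
  vector returns one column.\<close>

definition matnorm :: "nat \<Rightarrow> (real \<Rightarrow> complex ^ 'm ^ 'm) \<Rightarrow> real" where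
  "matnorm k A = (\<Sum>j\<in>UNIV. wnorm a b k (\<lambda>x. column j (A x)))"

lemma Wk_matrix_vector:
  "\<exists>C\<ge>0. \<forall>(A :: real \<Rightarrow> complex ^ 'm ^ 'm) y. (\<forall>j. Wk a b k (\<lambda>x. column j (A x))) \<longrightarrow> Wk a b k y \<longrightarrow>
     Wk a b k (\<lambda>x. A x *v y x) \<and> wnorm a b k (\<lambda>x. A x *v y x) \<le> C * matnorm k A * wnorm a b k y"
proof -
  obtain C where "C \<ge> 0" and C0: "\<forall>(w :: real \<Rightarrow> complex ^ 'm) v :: real \<Rightarrow> complex ^ 'm. \<forall>i. Wk a b k w \<longrightarrow> Wk a b k v \<longrightarrow>
     Wk a b k (\<lambda>x. w x $ i *s v x) \<and> wnorm a b k (\<lambda>x. w x $ i *s v x) \<le> C * wnorm a b k w * wnorm a b k v"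
    using Wk_component_smult [of k, where 'm = 'm] by blast
  note C = C0 [rule_format, THEN conjunct1] C0 [rule_format, THEN conjunct2]
  show ?thesis
  proof (intro exI [of _ C] conjI allI impI)
    fix A :: "real \<Rightarrow> complex ^ 'm ^ 'm" and y :: "real \<Rightarrow> complex ^ 'm"
    assume A: "\<forall>j. Wk a b k (\<lambda>x. column j (A x))" and y: "Wk a b k y"
    have *: "Wk a b k (\<lambda>x. y x $ j *s column j (A x))" for j
      using C(1) A y by blast
    show "Wk a b k (\<lambda>x. A x *v y x)"
      unfolding matrix_mult_sum by (intro Wk_sum *) simp
    have "wnorm a b k (\<lambda>x. A x *v y x) \<le> (\<Sum>j\<in>UNIV. wnorm a b k (\<lambda>x. y x $ j *s column j (A x)))"
      unfolding matrix_mult_sum by (intro Wk_sum *) simp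
    also have "\<dots> \<le> (\<Sum>j\<in>UNIV. C * wnorm a b k y * wnorm a b k (\<lambda>x. column j (A x)))"
      using C(2) A y by (intro sum_mono) blast
    also have "\<dots> = C * matnorm k A * wnorm a b k y"
      unfolding matnorm_def by (simp add: sum_distrib_left sum_distrib_right mult_ac)
    finally show "wnorm a b k (\<lambda>x. A x *v y x) \<le> C * matnorm k A * wnorm a b k y" .
  qed (use \<open>C \<ge> 0\<close> in simp)
qed

text \<open>Passes from the entrywise regularity in the theorem to columns, by writing a column as a
  sum of axis vectors.\<close>

lemma Wk_column:
  fixes A :: "real \<Rightarrow> complex ^ 'm ^ 'm"
  assumes "\<And>i. Wk a b k (\<lambda>x. A x $ i $ j)"
  shows "Wk a b k (\<lambda>x. column j (A x))"
proof -
  have "column j (A x) = (\<Sum>i\<in>UNIV. axis i (A x $ i $ j))" for x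
    by (simp add: vec_eq_iff column_def axis_def if_distrib [of "\<lambda>v. v $ _"] sum.delta cong: if_cong)
  then show ?thesis
    by (simp only:) (intro Wk_sum Wk_bounded_linear [OF bounded_linear_axis assms] finite)
qed

text \<open>Both later uses, nested balls and the Neumann iteration, supply geometric increments.
  Outside a single null set the values form a Cauchy sequence with tail at most
  \<open>2 * C / 2 ^ n\<close>, so their pointwise limit is also the limit in norm.\<close>

lemma Linf_complete:
  fixes X :: "nat \<Rightarrow> real \<Rightarrow> complex ^ 'm" and C :: real
  assumes L: "\<And>n. Linf a b (X n)" and le: "\<And>n. linf_norm a b (\<lambda>x. X (Suc n) x - X n x) \<le> C / 2 ^ n"
  shows "\<exists>y. Linf a b y \<and> (\<lambda>n. linf_norm a b (\<lambda>x. X n x - y x)) \<longlonglongrightarrow> 0"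
proof -
  have LD: "Linf a b (\<lambda>x. y x - z x)" if "Linf a b y" "Linf a b z" for y z :: "real \<Rightarrow> complex ^ 'm"
    using that Wk_diff [of 0 y z] by (simp add: Wk_0)
  have geo: "(\<lambda>n. 2 * C / 2 ^ n) \<longlonglongrightarrow> 0"
    by (intro LIMSEQ_divide_realpow_zero) simp
  have "ae (\<lambda>x. norm (X (Suc n) x - X n x) \<le> C / 2 ^ n)" for n
    using linf_norm_ae [OF LD [OF L L], of "Suc n" n] by eventually_elim (use le in \<open>meson order_trans\<close>)
  \<comment> \<open>Countably many null sets are discarded at once, so all increments are controlled
    at the same points.\<close>
  then have inc: "ae (\<lambda>x. \<forall>n. norm (X (Suc n) x - X n x) \<le> C / 2 ^ n)"
    by (simp add: AE_all_countable)
  define y where "y = (\<lambda>x. lim (\<lambda>n. X n x))"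
  have bound: "norm (X n x - y x) \<le> 2 * C / 2 ^ n" if x: "\<forall>n. norm (X (Suc n) x - X n x) \<le> C / 2 ^ n" for n x
  proof -
    \<comment> \<open>Keeping the remaining tail as a subtracted term lets the induction on
      \<open>j\<close> close.\<close>
    have tail: "norm (X (n + j) x - X n x) \<le> 2 * C / 2 ^ n - 2 * C / 2 ^ (n + j)" for n j
    proof (induction j)
      case (Suc j)
      have "norm (X (n + Suc j) x - X n x) \<le> norm (X (Suc (n + j)) x - X (n + j) x) + norm (X (n + j) x - X n x)"
        using norm_triangle_ineq [of "X (Suc (n + j)) x - X (n + j) x" "X (n + j) x - X n x"] by simp
      also have "\<dots> \<le> C / 2 ^ (n + j) + (2 * C / 2 ^ n - 2 * C / 2 ^ (n + j))"
        using x Suc by (intro add_mono) auto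
      also have "\<dots> = 2 * C / 2 ^ n - 2 * C / 2 ^ (n + Suc j)"
        by (simp add: field_simps)
      finally show ?case .
    qed simp
    have "0 \<le> C"
      using x [THEN spec, of 0] norm_ge_zero order_trans by (metis div_by_1 power_0)
    then have tail': "norm (X (n + j) x - X n x) \<le> 2 * C / 2 ^ n" for n j
      using tail [of n j] by (smt (verit) divide_nonneg_nonneg zero_le_power)
    have "Cauchy (\<lambda>n. X n x)"
    proof (rule CauchyI')
      fix e :: real assume "e > 0"
      then obtain M where M: "\<And>n. n \<ge> M \<Longrightarrow> 2 * C / 2 ^ n < e"
        using order_tendstoD(2) [OF geo] unfolding eventually_sequentially by blast
      show "\<exists>M. \<forall>m\<ge>M. \<forall>n>m. dist (X m x) (X n x) < e"
      proof (intro exI allI impI)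
        fix m n assume "m \<ge> M" "n > m"
        then show "dist (X m x) (X n x) < e"
          using tail' [of m "n - m"] M [of m] by (simp add: dist_norm norm_minus_commute)
      qed
    qed
    then have lim: "(\<lambda>n. X n x) \<longlonglongrightarrow> y x"
      unfolding y_def using Cauchy_convergent convergent_LIMSEQ_iff by blast
    have "(\<lambda>j. norm (X (n + j) x - X n x)) \<longlonglongrightarrow> norm (y x - X n x)"
      using LIMSEQ_ignore_initial_segment [OF lim, of n] by (intro tendsto_intros) (simp add: add.commute)
    then have "norm (y x - X n x) \<le> 2 * C / 2 ^ n"
      by (rule LIMSEQ_le_const2) (use tail' in blast)
    then show ?thesis
      by (simp add: norm_minus_commute)
  qed
  have ym: "y \<in> borel_measurable (lebesgue_on {a..b})"
    unfolding y_def using Linf_measurable [OF L] by (rule borel_measurable_lim_metric)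
  obtain B where B: "ae (\<lambda>x. norm (X 0 x) \<le> B)"
    using Linf_bound [OF L] ..
  have "ae (\<lambda>x. norm (y x) \<le> B + 2 * C)"
    using inc B
  proof eventually_elim
    case (elim x)
    have "norm (y x) \<le> norm (X 0 x) + norm (X 0 x - y x)"
      using norm_triangle_ineq2 [of "y x" "X 0 x"] by (simp add: norm_minus_commute)
    then show ?case
      using bound [OF elim(1), of 0] elim(2) by simp
  qed
  then have y: "Linf a b y"
    using ym Linf_I by blast
  have "linf_norm a b (\<lambda>x. X n x - y x) \<le> real CARD('m) * (2 * C / 2 ^ n)" for n
    by (rule linf_norm_le [OF LD [OF L y]]) (rule eventually_mono [OF inc], rule bound)
  then have le: "norm (linf_norm a b (\<lambda>x. X n x - y x)) \<le> real CARD('m) * (2 * C / 2 ^ n)" for n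
    using linf_norm_nonneg [OF LD [OF L y], of n] by simp
  have lim: "(\<lambda>n. real CARD('m) * (2 * C / 2 ^ n)) \<longlonglongrightarrow> 0"
    using tendsto_mult_left [OF geo] by force
  have "(\<lambda>n. linf_norm a b (\<lambda>x. X n x - y x)) \<longlonglongrightarrow> 0"
    by (rule null_sequence_comparison [OF le lim])
  then show ?thesis
    using y by auto
qed

text \<open>The derivatives converge to some \<open>h\<close> by induction, the functions to some
  \<open>y\<close> by \<open>Linf_complete\<close>. Passing to the limit in the representation of
  \<open>X n\<close> as a constant plus a primitive shows that \<open>h\<close> is the weak
  derivative of \<open>y\<close>.\<close>

lemma wnorm_complete:
  "(\<And>n. Wk a b k (X n)) \<Longrightarrow> (\<And>n. wnorm a b k (\<lambda>x. X (Suc n) x - X n x) \<le> C / 2 ^ n) \<Longrightarrow>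
     \<exists>y. Wk a b k y \<and> (\<lambda>n. wnorm a b k (\<lambda>x. X n x - y x :: complex ^ 'm)) \<longlonglongrightarrow> 0"
proof (induction k arbitrary: X)
  case 0
  have L: "Linf a b (X n)" for n
    using 0(1) by (simp add: Wk_0)
  have LD: "Linf a b (\<lambda>x. y x - z x)" if "Linf a b y" "Linf a b z" for y z :: "real \<Rightarrow> complex ^ 'm"
    using that Wk_diff [of 0 y z] by (simp add: Wk_0)
  have "linf_norm a b (\<lambda>x. X (Suc n) x - X n x) \<le> C / 2 ^ n" for n
    using 0(2) [of n] by (simp add: wnorm_0 LD L)
  then obtain y where y: "Linf a b y" "(\<lambda>n. linf_norm a b (\<lambda>x. X n x - y x)) \<longlonglongrightarrow> 0"
    using Linf_complete [of X C] L by blast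
  then show ?case
    by (intro exI [of _ y]) (simp add: Wk_0 wnorm_0 LD L)
next
  case (Suc k)
  define g where "g n = wderiv a b (X n)" for n
  have g: "weak_deriv (X n) (g n)" "Wk a b k (g n)" for n
    unfolding g_def using Suc.prems(1) weak_deriv_wderiv wnorm_wderiv_le(1) by blast+
  have dd: "weak_deriv (\<lambda>x. y x - z x) (\<lambda>x. h x - i x)" if "weak_deriv y h" "weak_deriv z i"
    for y z h i :: "real \<Rightarrow> complex ^ 'm"
    using weak_deriv_smult_add [OF that(2,1), of "-1"] by simp
  have eq: "wnorm a b (Suc k) (\<lambda>x. X m x - X n x) =
      linf_norm a b (\<lambda>x. X m x - X n x) + wnorm a b k (\<lambda>x. g m x - g n x)" for m n
    by (rule wnorm_Suc [OF dd [OF g(1) g(1)] Wk_diff [OF g(2) g(2)]])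
  have LX: "Linf a b (X n)" and LD: "Linf a b (\<lambda>x. X m x - X n x)" for m n
    using Wk_Linf [OF Suc.prems(1)] Wk_Linf [OF Wk_diff [OF Suc.prems(1) Suc.prems(1)]] by blast+
  have "wnorm a b k (\<lambda>x. g (Suc n) x - g n x) \<le> C / 2 ^ n" for n
    using Suc.prems(2) [of n] eq [of "Suc n" n] linf_norm_nonneg [OF LD, of "Suc n" n] by simp
  then obtain h where h: "Wk a b k h" "(\<lambda>n. wnorm a b k (\<lambda>x. g n x - h x)) \<longlonglongrightarrow> 0"
    using Suc.IH [of g] g(2) by blast
  have "linf_norm a b (\<lambda>x. X (Suc n) x - X n x) \<le> C / 2 ^ n" for n
    using Suc.prems(2) [of n] eq [of "Suc n" n] wnorm_nonneg [OF Wk_diff [OF g(2) g(2)], of "Suc n" n] by simp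
  then obtain y where y: "Linf a b y" "(\<lambda>n. linf_norm a b (\<lambda>x. X n x - y x)) \<longlonglongrightarrow> 0"
    using Linf_complete [of X C] LX by blast
  let ?e = "\<lambda>n. linf_norm a b (\<lambda>x. X n x - y x)" and ?f = "\<lambda>n. wnorm a b k (\<lambda>x. g n x - h x)"
  have LXy: "Linf a b (\<lambda>x. X n x - y x)" for n
    using LX y(1) Wk_diff [of 0 "X n" y] by (simp add: Wk_0)
  have "\<forall>n. \<exists>c. aeq a b (X n) (\<lambda>x. c + integral {a..x} (g n))"
    using g(1) unfolding weak_deriv_def by blast
  then obtain c where "aeq a b (X n) (\<lambda>x. c n + integral {a..x} (g n))" for n
    by metis
  then have "ae (\<lambda>x. X n x = c n + integral {a..x} (g n) \<and> norm (X n x - y x) \<le> ?e n)" for n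
    using linf_norm_ae [OF LXy, of n] unfolding aeq_def by (intro AE_conjI)
  then have all: "ae (\<lambda>x. \<forall>n. X n x = c n + integral {a..x} (g n) \<and> norm (X n x - y x) \<le> ?e n)"
    by (simp only: AE_all_countable) simp
  have int: "(\<lambda>n. integral {a..x} (g n)) \<longlonglongrightarrow> integral {a..x} h" if x: "x \<in> {a..b}" for x
  proof -
    have le: "norm (integral {a..x} (g n) - integral {a..x} h) \<le> ?f n * (x - a)" for n
    proof -
      have gh: "Wk a b k (\<lambda>x. g n x - h x)"
        by (intro Wk_diff g(2) h(1))
      have "integral {a..x} (g n) - integral {a..x} h = integral {a..x} (\<lambda>x. g n x - h x)"
        using x by (intro Henstock_Kurzweil_Integration.integral_diff [symmetric] Linf_integrable_sub)
          (auto intro: Wk_Linf g(2) h(1))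
      moreover have "ae (\<lambda>r. r \<in> {a..x} \<longrightarrow> norm (g n r - h r) \<le> ?f n)"
        using linf_norm_ae [OF Wk_Linf [OF gh]] by eventually_elim (use linf_norm_le_wnorm [OF gh] in linarith)
      ultimately show ?thesis
        using x norm_integral_ae_bound [OF Wk_Linf [OF gh] wnorm_nonneg [OF gh]] by simp
    qed
    have "(\<lambda>n. ?f n * (x - a)) \<longlonglongrightarrow> 0"
      using tendsto_mult_right [OF h(2)] by force
    with le have "(\<lambda>n. integral {a..x} (g n) - integral {a..x} h) \<longlonglongrightarrow> 0"
      by (rule null_sequence_comparison)
    then show ?thesis
      by (simp add: LIM_zero_iff)
  qed
  have lim: "(\<lambda>n. X n x) \<longlonglongrightarrow> y x" if "\<forall>n. X n x = c n + integral {a..x} (g n) \<and> norm (X n x - y x) \<le> ?e n" for x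
  proof -
    have "(\<lambda>n. X n x - y x) \<longlonglongrightarrow> 0"
      by (rule null_sequence_comparison [OF _ y(2)]) (use that in blast)
    then show ?thesis
      by (simp add: LIM_zero_iff)
  qed
  \<comment> \<open>One good point fixes the limit of the constants \<open>c n\<close>, because the
    functions and the integrals both converge there.\<close>
  obtain x0 where x0: "x0 \<in> {a..b}" "\<forall>n. X n x0 = c n + integral {a..x0} (g n) \<and> norm (X n x0 - y x0) \<le> ?e n"
    using ae_ex [OF all] by blast
  have "(\<lambda>n. X n x0 - integral {a..x0} (g n)) \<longlonglongrightarrow> y x0 - integral {a..x0} h"
    by (intro tendsto_diff lim int x0)
  then have c: "c \<longlonglongrightarrow> y x0 - integral {a..x0} h"
    using x0(2) by simp
  have "ae (\<lambda>x. y x = (y x0 - integral {a..x0} h) + integral {a..x} h)"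
    using all ae_in
  proof eventually_elim
    case (elim x)
    have "(\<lambda>n. X n x) \<longlonglongrightarrow> (y x0 - integral {a..x0} h) + integral {a..x} h"
      using tendsto_add [OF c int [OF elim(2)]] elim(1) by simp
    then show ?case
      using lim [OF elim(1)] LIMSEQ_unique by blast
  qed
  then have yh: "weak_deriv y h"
    unfolding weak_deriv_def aeq_def using Wk_Linf [OF h(1)] by blast
  have "wnorm a b (Suc k) (\<lambda>x. X n x - y x) = ?e n + ?f n" for n
    by (rule wnorm_Suc [OF dd [OF g(1) yh] Wk_diff [OF g(2) h(1)]])
  then have "(\<lambda>n. wnorm a b (Suc k) (\<lambda>x. X n x - y x)) \<longlonglongrightarrow> 0"
    using tendsto_add [OF y(2) h(2)] by simp
  then show ?case
    using yh h(1) Wk_Suc by blast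
qed

subsection \<open>Uniform boundedness and Neumann series\<close>

text \<open>
  The proof nests balls, the seminorm of some parameter below \<open>1 / (l + 1)\<close> exceeding \<open>l\<close> on the
  ball of step \<open>l + 1\<close>, which contradicts the pointwise bound at the common point.
\<close>

lemma uniform_boundedness:
  fixes q :: "real \<Rightarrow> (real \<Rightarrow> complex ^ 'm) \<Rightarrow> real"
  assumes "0 < \<delta>0"
    and sub: "\<And>e y z. 0 < e \<Longrightarrow> e < \<delta>0 \<Longrightarrow> Wk a b k y \<Longrightarrow> Wk a b k z \<Longrightarrow> q e (\<lambda>x. y x + z x) \<le> q e y + q e z"
    and hom: "\<And>e y c. 0 < e \<Longrightarrow> e < \<delta>0 \<Longrightarrow> Wk a b k y \<Longrightarrow> q e (\<lambda>x. c *s y x) \<le> cmod c * q e y"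
    and bdd: "\<And>e. 0 < e \<Longrightarrow> e < \<delta>0 \<Longrightarrow> \<exists>C. \<forall>y. Wk a b k y \<longrightarrow> q e y \<le> C * wnorm a b k y"
    and ptw: "\<And>y. Wk a b k y \<Longrightarrow> \<exists>C. \<forall>\<^sub>F e in at_right 0. q e y \<le> C"
  shows "\<exists>\<delta>>0. \<exists>M\<ge>0. \<forall>e y. 0 < e \<longrightarrow> e < \<delta> \<longrightarrow> Wk a b k y \<longrightarrow> q e y \<le> M * wnorm a b k y"
proof (rule ccontr)
  assume "\<not> ?thesis"
  then have unbdd: "\<exists>e y. 0 < e \<and> e < \<delta> \<and> Wk a b k y \<and> M * wnorm a b k y < q e y" if "\<delta> > 0" "M \<ge> 0" for \<delta> M
    using that by (meson not_le_imp_less)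
  \<comment> \<open>A state is the centre and radius of a ball. The radius at least halves, the
    second condition puts the new ball inside the old one, and the third makes one seminorm large
    throughout the new ball.\<close>
  define step where "step = (\<lambda>(l :: nat) (x, r :: real) (x', r').
    r' \<le> r / 2 \<and> wnorm a b k (\<lambda>t. x' t - x t) + r' \<le> r \<and>
    (\<exists>e. 0 < e \<and> e < 1 / (real l + 1) \<and>
      (\<forall>z. Wk a b k z \<longrightarrow> wnorm a b k (\<lambda>t. z t - x' t) \<le> r' \<longrightarrow> real l < q e z)))"
  have ex: "\<exists>s'. (Wk a b k (fst s') \<and> 0 < snd s' \<and> snd s' \<le> 1 / 2 ^ Suc l) \<and> step l s s'"
    if s: "Wk a b k (fst s) \<and> 0 < snd s \<and> snd s \<le> 1 / 2 ^ l" for s l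
  proof -
    obtain x r where xr: "s = (x, r)" "Wk a b k x" "0 < r" "r \<le> 1 / 2 ^ l"
      using s by (cases s) auto
    obtain Cx \<eta> where Cx: "\<eta> > 0" "\<And>e. 0 < e \<Longrightarrow> e < \<eta> \<Longrightarrow> q e x \<le> Cx"
      using ptw [OF xr(2)] unfolding eventually_at_right_field by auto
    \<comment> \<open>Once \<open>y\<close> is rescaled to norm \<open>r / 2\<close>, exceeding
      \<open>M\<close> means exceeding \<open>real l + 1 + \<bar>Cx\<bar>\<close>. The last summand
      offsets the seminorm at the old centre, the 1 its variation over the new ball.\<close>
    define M where "M = 2 * (real l + 1 + \<bar>Cx\<bar>) / r"
    have "M > 0"
      using xr by (simp add: M_def)
    obtain e y where ey: "0 < e" "e < \<delta>0" "e < \<eta>" "e < 1 / (real l + 1)" "Wk a b k y" "M * wnorm a b k y < q e y"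
      using unbdd [of "min (min \<delta>0 \<eta>) (1 / (real l + 1))" M] \<open>0 < \<delta>0\<close> Cx(1) \<open>M > 0\<close> by auto
    obtain C where C: "\<And>y. Wk a b k y \<Longrightarrow> q e y \<le> C * wnorm a b k y"
      using bdd [OF ey(1,2)] by blast
    define p where "p = wnorm a b k y"
    \<comment> \<open>If the norm were 0, boundedness for this fixed \<open>e\<close> would make the
      seminorm at most 0, contrary to the choice of \<open>y\<close>.\<close>
    have "p \<noteq> 0"
      using C [OF ey(5)] ey(6) by (auto simp: p_def)
    then have "p > 0"
      using wnorm_nonneg [OF ey(5)] by (simp add: p_def)
    define \<xi> where "\<xi> = (\<lambda>t. complex_of_real (r / (2 * p)) *s y t)"
    have \<xi>: "Wk a b k \<xi>" "wnorm a b k \<xi> \<le> r / 2"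
      using Wk_smult [OF ey(5)] wnorm_smult_le [OF ey(5), of "complex_of_real (r / (2 * p))"] xr(3) \<open>p > 0\<close>
      by (simp_all add: \<xi>_def p_def [symmetric] norm_divide norm_mult)
    have "q e y \<le> 2 * p / r * q e \<xi>"
      using hom [OF ey(1,2) \<xi>(1), of "complex_of_real (2 * p / r)"] xr(3) \<open>p > 0\<close>
      by (simp add: \<xi>_def norm_divide norm_mult)
    then have "M * p < 2 * p / r * q e \<xi>"
      using ey(6) by (simp add: p_def)
    then have "2 * p / r * (real l + 1 + \<bar>Cx\<bar>) < 2 * p / r * q e \<xi>"
      by (simp add: M_def mult_ac)
    moreover have "0 < 2 * p / r"
      using xr(3) \<open>p > 0\<close> by simp
    ultimately have q\<xi>: "real l + 1 + \<bar>Cx\<bar> < q e \<xi>"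
      by (simp only: mult_less_cancel_left_pos)
    define x' where "x' = (\<lambda>t. x t + \<xi> t)"
    have x': "Wk a b k x'"
      unfolding x'_def by (intro Wk_add xr \<xi>)
    have "q e \<xi> \<le> q e x' + q e (\<lambda>t. (-1) *s x t)"
      using sub [OF ey(1,2) x' Wk_smult [OF xr(2), of "-1"]] by (simp add: x'_def)
    then have qx': "real l + 1 < q e x'"
      using hom [OF ey(1,2) xr(2), of "-1"] Cx(2) [OF ey(1,3)] q\<xi> by simp
    \<comment> \<open>With \<open>\<bar>C\<bar> * r' \<le> 1\<close> the seminorm falls by at most 1
      from its value at \<open>x'\<close>, so it stays above \<open>l\<close> on the ball.\<close>
    define r' where "r' = min (r / 2) (1 / (\<bar>C\<bar> + 1))"
    have "\<bar>C\<bar> * r' \<le> \<bar>C\<bar> * (1 / (\<bar>C\<bar> + 1))"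
      by (intro mult_left_mono) (simp_all add: r'_def)
    also have "\<dots> \<le> 1"
      by simp
    finally have r': "0 < r'" "r' \<le> r / 2" "\<bar>C\<bar> * r' \<le> 1"
      using xr(3) by (simp_all add: r'_def)
    have "real l < q e z" if z: "Wk a b k z" "wnorm a b k (\<lambda>t. z t - x' t) \<le> r'" for z
    proof -
      have w: "Wk a b k (\<lambda>t. x' t - z t)"
        by (intro Wk_diff x' z)
      have "q e x' \<le> q e z + q e (\<lambda>t. x' t - z t)"
        using sub [OF ey(1,2) z(1) w] by simp
      moreover have "q e (\<lambda>t. x' t - z t) \<le> \<bar>C\<bar> * wnorm a b k (\<lambda>t. x' t - z t)"
        using C [OF w] mult_right_mono [OF abs_ge_self [of C] wnorm_nonneg [OF w]] by linarith
      moreover have "\<bar>C\<bar> * wnorm a b k (\<lambda>t. x' t - z t) \<le> \<bar>C\<bar> * r'"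
        using z(2) wnorm_minus_commute [OF z(1) x'] by (intro mult_left_mono) auto
      ultimately show ?thesis
        using qx' r'(3) by linarith
    qed
    moreover have "(\<lambda>t. x' t - x t) = \<xi>"
      by (simp add: x'_def)
    ultimately have "step l s (x', r')"
      using r' \<xi>(2) ey(1,4) unfolding step_def xr(1) by auto
    moreover have "r' \<le> 1 / 2 ^ Suc l"
      using r'(2) xr(4) by simp
    ultimately show ?thesis
      using x' r'(1) by (intro exI [of _ "(x', r')"]) simp
  qed
  have "\<exists>s :: (real \<Rightarrow> complex ^ 'm) \<times> real. Wk a b k (fst s) \<and> 0 < snd s \<and> snd s \<le> 1 / 2 ^ 0"
    by (intro exI [of _ "(\<lambda>x. 0, 1)"]) (simp add: Wk_const)
  then obtain s where s: "\<And>n. Wk a b k (fst (s n)) \<and> 0 < snd (s n) \<and> snd (s n) \<le> 1 / 2 ^ n" "\<And>n. step n (s n) (s (Suc n))"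
    using dependent_nat_choice [of "\<lambda>n s. Wk a b k (fst s) \<and> 0 < snd s \<and> snd s \<le> 1 / 2 ^ n" step] ex by blast
  define X where "X n = fst (s n)" for n
  define R where "R n = snd (s n)" for n
  have X: "Wk a b k (X n)" and R: "0 < R n" "R n \<le> 1 / 2 ^ n" for n
    using s(1) [of n] by (simp_all add: X_def R_def)
  have st: "R (Suc n) \<le> R n / 2" "wnorm a b k (\<lambda>t. X (Suc n) t - X n t) + R (Suc n) \<le> R n"
    "\<exists>e. 0 < e \<and> e < 1 / (real n + 1) \<and>
      (\<forall>z. Wk a b k z \<longrightarrow> wnorm a b k (\<lambda>t. z t - X (Suc n) t) \<le> R (Suc n) \<longrightarrow> real n < q e z)" for n
    using s(2) [of n] unfolding step_def X_def R_def by (simp_all add: case_prod_unfold)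
  have "wnorm a b k (\<lambda>t. X (Suc n) t - X n t) \<le> 1 / 2 ^ n" for n
    using st(2) [of n] R [of n] R(1) [of "Suc n"] by linarith
  then obtain y where y: "Wk a b k y" "(\<lambda>n. wnorm a b k (\<lambda>t. X n t - y t)) \<longlonglongrightarrow> 0"
    using wnorm_complete [of k X 1] X by blast
  have nest: "wnorm a b k (\<lambda>t. X (n + j) t - X n t) + R (n + j) \<le> R n" for n j
  proof (induction j)
    case (Suc j)
    have "wnorm a b k (\<lambda>t. X (n + Suc j) t - X n t) \<le>
        wnorm a b k (\<lambda>t. X (Suc (n + j)) t - X (n + j) t) + wnorm a b k (\<lambda>t. X (n + j) t - X n t)"
      using wnorm_triangle [OF X X X, of "n + Suc j" n "n + j"] by simp
    then show ?case
      using Suc st(2) [of "n + j"] by simp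
  qed (simp add: wnorm_zero)
  \<comment> \<open>All later centres lie in the \<open>n\<close>th ball, and so does their limit,
    the ball being closed.\<close>
  have near: "wnorm a b k (\<lambda>t. y t - X n t) \<le> R n" for n
  proof -
    have "wnorm a b k (\<lambda>t. y t - X n t) \<le> wnorm a b k (\<lambda>t. X (j + n) t - y t) + R n" for j
      using wnorm_triangle [OF y(1) X X, of n "j + n"] nest [of n j] R(1) [of "n + j"]
        wnorm_minus_commute [OF y(1) X, of "j + n"] by (simp add: add.commute)
    moreover have "(\<lambda>j. wnorm a b k (\<lambda>t. X (j + n) t - y t) + R n) \<longlonglongrightarrow> 0 + R n"
      by (intro tendsto_intros LIMSEQ_ignore_initial_segment [OF y(2)])
    ultimately show ?thesis
      using LIMSEQ_le_const [of _ "R n"] by simp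
  qed
  obtain C \<eta> where C: "\<eta> > 0" "\<And>e. 0 < e \<Longrightarrow> e < \<eta> \<Longrightarrow> q e y \<le> C"
    using ptw [OF y(1)] unfolding eventually_at_right_field by auto
  \<comment> \<open>A large \<open>l\<close> serves twice: it exceeds the pointwise bound
    \<open>C\<close>, and \<open>1 / (l + 1) < \<eta>\<close> places the parameter where that bound
    holds.\<close>
  obtain l :: nat where l: "max C (1 / \<eta>) < l"
    using reals_Archimedean2 by blast
  obtain e where e: "0 < e" "e < 1 / (real l + 1)" "real l < q e y"
    using st(3) [of l] near [of "Suc l"] y(1) by blast
  have "1 / (real l + 1) < \<eta>"
    using l C(1) by (simp add: field_simps)
  then show False
    using C(2) [of e] e l by simp
qed

text \<open>Only the square of \<open>K\<close> is a contraction, so the iteration that sends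
  \<open>X\<close> to \<open>f - K X\<close> contracts every two steps. For the estimate, with
  \<open>f\<close> for \<open>y + K y\<close>, inserting \<open>y = f - K y\<close> into itself
  gives \<open>y = f - K f + K (K y)\<close>.\<close>

lemma neumann_series:
  fixes K :: "(real \<Rightarrow> complex ^ 'm) \<Rightarrow> real \<Rightarrow> complex ^ 'm"
  assumes K: "\<And>y. Wk a b k y \<Longrightarrow> Wk a b k (K y)"
    and lin: "\<And>y z. Wk a b k y \<Longrightarrow> Wk a b k z \<Longrightarrow> aeq a b (K (\<lambda>x. y x - z x)) (\<lambda>x. K y x - K z x)"
    and M: "0 \<le> M" "\<And>y. Wk a b k y \<Longrightarrow> wnorm a b k (K y) \<le> M * wnorm a b k y"
    and K2: "\<And>y. Wk a b k y \<Longrightarrow> wnorm a b k (K (K y)) \<le> wnorm a b k y / 4"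
  shows "Wk a b k f \<Longrightarrow> \<exists>y. Wk a b k y \<and> aeq a b (\<lambda>x. y x + K y x) f"
    and "Wk a b k y \<Longrightarrow> wnorm a b k y \<le> 4 / 3 * (1 + M) * wnorm a b k (\<lambda>x. y x + K y x)"
proof -
  have lin': "wnorm a b k (\<lambda>x. K y x - K z x) = wnorm a b k (K (\<lambda>x. y x - z x))"
    if "Wk a b k y" "Wk a b k z" for y z
    using wnorm_aeq [OF lin [OF that]] by simp
  show "\<exists>y. Wk a b k y \<and> aeq a b (\<lambda>x. y x + K y x) f" if f: "Wk a b k f"
  proof -
    define X where "X = rec_nat f (\<lambda>n y x. f x - K y x)"
    have X0: "X 0 = f" and XS: "\<And>n. X (Suc n) = (\<lambda>x. f x - K (X n) x)"
      by (simp_all add: X_def)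
    have X: "Wk a b k (X n)" for n
      by (induction n) (simp_all add: X0 XS f K Wk_diff)
    define d where "d n = wnorm a b k (\<lambda>x. X (Suc n) x - X n x)" for n
    have d1: "d (Suc n) = wnorm a b k (K (\<lambda>x. X n x - X (Suc n) x))" for n
      using lin' [OF X X, of n "Suc n"] by (simp add: d_def XS)
    have d2: "d (Suc (Suc n)) \<le> d n / 4" for n
    proof -
      let ?u = "\<lambda>x. X (Suc n) x - X n x" and ?v = "\<lambda>x. X (Suc n) x - X (Suc (Suc n)) x"
      have u: "Wk a b k ?u" and v: "Wk a b k ?v"
        by (intro Wk_diff X)+
      have "aeq a b (K ?u) ?v"
        using lin [OF X X, of "Suc n" n] by (simp add: XS)
      \<comment> \<open>\<open>K\<close> is not assumed to respect a.e. equality; its boundedness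
        supplies this, since a difference of norm 0 is sent to one of norm 0.\<close>
      then have "aeq a b (\<lambda>x. K ?u x - ?v x) (\<lambda>x. 0)"
        unfolding aeq_def by eventually_elim simp
      then have "wnorm a b k (\<lambda>x. K ?u x - ?v x) = 0"
        using wnorm_aeq wnorm_zero by metis
      then have "wnorm a b k (\<lambda>x. K (K ?u) x - K ?v x) \<le> 0"
        using lin' [OF K [OF u] v] M(2) [OF Wk_diff [OF K [OF u] v]] by simp
      then have "aeq a b (\<lambda>x. K (K ?u) x - K ?v x) (\<lambda>x. 0)"
        by (rule wnorm_eq_0_imp [OF Wk_diff [OF K [OF K [OF u]] K [OF v]]])
      then have "aeq a b (K (K ?u)) (K ?v)"
        unfolding aeq_def by eventually_elim simp
      then show ?thesis
        using wnorm_aeq [of "K (K ?u)" "K ?v" k] K2 [OF u] d1 [of "Suc n"] by (simp add: d_def)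
    qed
    \<comment> \<open>A factor 1/4 for two steps amounts to 1/2 for each;
      \<open>d 0 + 2 * d 1\<close> accommodates both starting values.\<close>
    have geo: "d n \<le> (d 0 + 2 * d 1) / 2 ^ n \<and> d (Suc n) \<le> (d 0 + 2 * d 1) / 2 ^ Suc n" for n
    proof (induction n)
      case 0
      have "0 \<le> d 0" "0 \<le> d 1"
        unfolding d_def by (intro wnorm_nonneg Wk_diff X)+
      then show ?case
        by simp
    next
      case (Suc n)
      then show ?case
        using d2 [of n] by simp
    qed
    obtain y where y: "Wk a b k y" "(\<lambda>n. wnorm a b k (\<lambda>x. X n x - y x)) \<longlonglongrightarrow> 0"
      using wnorm_complete [of k X "d 0 + 2 * d 1"] X geo unfolding d_def by blast
    have Wf: "Wk a b k (\<lambda>x. (y x + K y x) - f x)"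
      by (intro Wk_diff Wk_add y K f)
    have "wnorm a b k (\<lambda>x. (y x + K y x) - f x) \<le>
        wnorm a b k (\<lambda>x. X (Suc n) x - y x) + M * wnorm a b k (\<lambda>x. X n x - y x)" for n
    proof -
      have "wnorm a b k (\<lambda>x. (y x + K y x) - f x) = wnorm a b k (\<lambda>x. (y x - X (Suc n) x) + (K y x - K (X n) x))"
        by (simp add: XS algebra_simps)
      also have "\<dots> \<le> wnorm a b k (\<lambda>x. y x - X (Suc n) x) + wnorm a b k (\<lambda>x. K y x - K (X n) x)"
        by (intro wnorm_add_le Wk_diff y X K)
      also have "wnorm a b k (\<lambda>x. K y x - K (X n) x) \<le> M * wnorm a b k (\<lambda>x. y x - X n x)"
        using lin' [OF y(1) X] M(2) [OF Wk_diff [OF y(1) X]] by simp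
      finally show ?thesis
        using wnorm_minus_commute [OF y(1) X, of n] wnorm_minus_commute [OF y(1) X, of "Suc n"] by simp
    qed
    moreover have "(\<lambda>n. wnorm a b k (\<lambda>x. X (Suc n) x - y x) + M * wnorm a b k (\<lambda>x. X n x - y x)) \<longlonglongrightarrow> 0 + M * 0"
      by (intro tendsto_intros y(2) LIMSEQ_Suc [OF y(2)])
    ultimately have "wnorm a b k (\<lambda>x. (y x + K y x) - f x) \<le> 0"
      using LIMSEQ_le_const by fastforce
    then have "aeq a b (\<lambda>x. (y x + K y x) - f x) (\<lambda>x. 0)"
      by (rule wnorm_eq_0_imp [OF Wf])
    then have "aeq a b (\<lambda>x. y x + K y x) f"
      unfolding aeq_def by eventually_elim simp
    then show ?thesis
      using y(1) by blast
  qed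
  show "wnorm a b k y \<le> 4 / 3 * (1 + M) * wnorm a b k (\<lambda>x. y x + K y x)" if y: "Wk a b k y"
  proof -
    let ?f = "\<lambda>x. y x + K y x"
    have f: "Wk a b k ?f"
      by (intro Wk_add y K)
    have "wnorm a b k y \<le> wnorm a b k ?f + wnorm a b k (K y)"
      using wnorm_diff_le [OF f K [OF y]] by simp
    moreover have "wnorm a b k (K y) = wnorm a b k (\<lambda>x. K ?f x - K (K y) x)"
      using lin' [OF f K [OF y]] by simp
    moreover have "\<dots> \<le> M * wnorm a b k ?f + wnorm a b k y / 4"
      using wnorm_diff_le [OF K [OF f] K [OF K [OF y]]] M(2) [OF f] K2 [OF y] by linarith
    \<comment> \<open>The quarter of the norm of \<open>y\<close> moves to the left and leaves three
      quarters there, whence the factor 4/3.\<close>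
    ultimately show ?thesis
      by (simp add: algebra_simps)
  qed
qed

subsection \<open>Boundary value problems\<close>

lemma Lop_Wk:
  assumes "\<And>j. Wk a b k (\<lambda>x. column j (A x))" "Wk a b (Suc k) y"
  shows "Wk a b k (Lop a b A y)"
  unfolding Lop_def
  using Wk_add [OF wnorm_wderiv_le(1) [OF assms(2)]] Wk_matrix_vector [of k] assms(1) Wk_Suc_imp [OF assms(2)] by blast

lemma Lop_bound:
  assumes "\<And>j. Wk a b k (\<lambda>x. column j (A x :: complex ^ 'm ^ 'm))"
  shows "\<exists>C\<ge>0. \<forall>y. Wk a b (Suc k) y \<longrightarrow> wnorm a b k (Lop a b A y) \<le> C * wnorm a b (Suc k) y"
proof -
  obtain C where C: "0 \<le> C" "\<forall>(A :: real \<Rightarrow> complex ^ 'm ^ 'm) y. (\<forall>j. Wk a b k (\<lambda>x. column j (A x))) \<longrightarrow> Wk a b k y \<longrightarrow>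
     Wk a b k (\<lambda>x. A x *v y x) \<and> wnorm a b k (\<lambda>x. A x *v y x) \<le> C * matnorm k A * wnorm a b k y"
    using Wk_matrix_vector [of k, where 'm = 'm] by blast
  have m: "0 \<le> matnorm k A"
    unfolding matnorm_def by (intro sum_nonneg wnorm_nonneg assms)
  show ?thesis
  proof (intro exI [of _ "1 + C * matnorm k A"] conjI allI impI)
    fix y :: "real \<Rightarrow> complex ^ 'm" assume y: "Wk a b (Suc k) y"
    note y' = Wk_Suc_imp [OF y]
    have Ay: "Wk a b k (\<lambda>x. A x *v y x)" "wnorm a b k (\<lambda>x. A x *v y x) \<le> C * matnorm k A * wnorm a b k y"
      using C(2) assms y' by blast+
    have "wnorm a b k (Lop a b A y) \<le> wnorm a b k (wderiv a b y) + wnorm a b k (\<lambda>x. A x *v y x)"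
      unfolding Lop_def by (intro wnorm_add_le wnorm_wderiv_le(1) y Ay)
    also have "\<dots> \<le> wnorm a b (Suc k) y + C * matnorm k A * wnorm a b (Suc k) y"
      using wnorm_wderiv_le(2) [OF y] Ay(2) mult_left_mono [OF wnorm_le_Suc [OF y], of "C * matnorm k A"] C(1) m by simp
    finally show "wnorm a b k (Lop a b A y) \<le> (1 + C * matnorm k A) * wnorm a b (Suc k) y"
      by (simp add: algebra_simps)
  qed (use C m in simp)
qed

lemma wderiv_smult_add:
  assumes "Wk a b (Suc k) y" "Wk a b (Suc k) z"
  shows "aeq a b (wderiv a b (\<lambda>x. c *s y x + z x)) (\<lambda>x. c *s wderiv a b y x + wderiv a b z x)"
  using assms Wk_smult_add [OF assms]
  by (intro weak_deriv_unique [OF weak_deriv_wderiv weak_deriv_smult_add [OF weak_deriv_wderiv weak_deriv_wderiv]]) auto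

lemma Lop_smult_add:
  assumes "Wk a b (Suc k) y" "Wk a b (Suc k) z"
  shows "aeq a b (Lop a b A (\<lambda>x. c *s y x + z x)) (\<lambda>x. c *s Lop a b A y x + Lop a b A z x)"
  using wderiv_smult_add [OF assms, of c] unfolding aeq_def Lop_def
proof eventually_elim
  case (elim x)
  then show ?case
    by (simp add: matrix_vector_right_distrib matrix_vector_mult_def vec_eq_iff sum_distrib_left sum.distrib algebra_simps)
qed

lemma Lop_diff:
  assumes "Wk a b (Suc k) y" "Wk a b (Suc k) z"
  shows "aeq a b (Lop a b A (\<lambda>x. y x - z x)) (\<lambda>x. Lop a b A y x - Lop a b A z x)"
  using Lop_smult_add [OF assms(2,1), of A "-1"] by simp

lemma Lop_aeq:
  assumes "Wk a b (Suc k) y" "aeq a b y z"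
  shows "aeq a b (Lop a b A y) (Lop a b A z)"
proof -
  have "Wk a b (Suc k) z"
    using assms Wk_aeq by blast
  then have "aeq a b (wderiv a b y) (wderiv a b z)"
    using weak_deriv_unique [OF weak_deriv_aeq [OF weak_deriv_wderiv [OF assms(1)] assms(2) aeq_refl] weak_deriv_wderiv] by blast
  then show ?thesis
    using assms(2) unfolding aeq_def Lop_def by eventually_elim simp
qed

text \<open>Both operators contain the same chosen \<open>wderiv\<close>, so the identity holds at
  every point, and their difference is a multiplication, which loses no derivative.\<close>

lemma Lop_perturb: "Lop a b A' y x = Lop a b A y x + (A' x - A x) *v y x"
  by (simp add: Lop_def matrix_vector_mult_diff_rdistrib)

section \<open>Bounded linear boundary functionals\<close>

context
  fixes k :: nat and B :: "(real \<Rightarrow> complex ^ 'm) \<Rightarrow> complex ^ 'm"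
  assumes B: "bdd_lin_B a b (Suc k) B"
begin

lemma functional_aeq: "Wk a b (Suc k) y \<Longrightarrow> aeq a b y z \<Longrightarrow> B y = B z"
  using B Wk_aeq unfolding bdd_lin_B_def by blast

lemma functional_smult_add:
  "Wk a b (Suc k) y \<Longrightarrow> Wk a b (Suc k) z \<Longrightarrow> B (\<lambda>x. c *s y x + z x) = c *s B y + B z"
  using B unfolding bdd_lin_B_def by blast

lemma functional_add: "Wk a b (Suc k) y \<Longrightarrow> Wk a b (Suc k) z \<Longrightarrow> B (\<lambda>x. y x + z x) = B y + B z"
  using functional_smult_add [of y z 1] by simp

lemma functional_diff: "Wk a b (Suc k) y \<Longrightarrow> Wk a b (Suc k) z \<Longrightarrow> B (\<lambda>x. y x - z x) = B y - B z"
  using functional_smult_add [of z y "-1"] by simp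

lemma functional_smult: "Wk a b (Suc k) y \<Longrightarrow> B (\<lambda>x. c *s y x) = c *s B y"
  using functional_smult_add [of y "\<lambda>x. 0" c] functional_smult_add [of "\<lambda>x. 0" "\<lambda>x. 0" 1]
  by (simp add: Wk_const)

lemma functional_bound: "\<exists>C\<ge>0. \<forall>y. Wk a b (Suc k) y \<longrightarrow> norm (B y) \<le> C * wnorm a b (Suc k) y"
proof -
  obtain C where C: "\<forall>y. Wk a b (Suc k) y \<longrightarrow> norm (B y) \<le> C * wnorm a b (Suc k) y"
    using B unfolding bdd_lin_B_def by blast
  have "norm (B y) \<le> \<bar>C\<bar> * wnorm a b (Suc k) y" if "Wk a b (Suc k) y" for y
    using C that mult_right_mono [OF abs_ge_self [of C] wnorm_nonneg [OF that]] by (meson order_trans)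
  then show ?thesis
    by (intro exI [of _ "\<bar>C\<bar>"]) simp
qed

end

section \<open>Properties of a given inverse\<close>

context
  fixes k :: nat and A :: "real \<Rightarrow> complex ^ 'm ^ 'm" and B S
  assumes S: "is_inverse a b (Suc k) A B S"
begin

lemma inverse_Wk: "Wk a b k f \<Longrightarrow> Wk a b (Suc k) (S f c)"
  using S unfolding is_inverse_def diff_Suc_1 by blast

lemma inverse_aeq: "Wk a b k f \<Longrightarrow> aeq a b f g \<Longrightarrow> aeq a b (S f c) (S g c)"
  using S Wk_aeq unfolding is_inverse_def diff_Suc_1 by blast

lemma inverse_smult_add:
  "Wk a b k f \<Longrightarrow> Wk a b k g \<Longrightarrow>
    aeq a b (S (\<lambda>x. \<alpha> *s f x + g x) (\<alpha> *s c + d)) (\<lambda>x. \<alpha> *s S f c x + S g d x)"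
  using S unfolding is_inverse_def diff_Suc_1 by blast

lemma inverse_add:
  "Wk a b k f \<Longrightarrow> Wk a b k g \<Longrightarrow> aeq a b (S (\<lambda>x. f x + g x) (c + d)) (\<lambda>x. S f c x + S g d x)"
  using inverse_smult_add [of f g 1 c d] by simp

lemma inverse_diff:
  "Wk a b k f \<Longrightarrow> Wk a b k g \<Longrightarrow> aeq a b (S (\<lambda>x. f x - g x) (c - d)) (\<lambda>x. S f c x - S g d x)"
  using inverse_smult_add [of g f "-1" d c] by simp

lemma inverse_smult_add_0:
  "aeq a b (S (\<lambda>x. 0) (\<alpha> *s c + d)) (\<lambda>x. \<alpha> *s S (\<lambda>x. 0) c x + S (\<lambda>x. 0) d x)"
  using inverse_smult_add [of "\<lambda>x. 0" "\<lambda>x. 0" \<alpha> c d] by (simp add: Wk_const)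

lemma inverse_left: "Wk a b (Suc k) y \<Longrightarrow> aeq a b (S (Lop a b A y) (B y)) y"
  using S unfolding is_inverse_def diff_Suc_1 by blast

lemma inverse_Lop: "Wk a b k f \<Longrightarrow> aeq a b (Lop a b A (S f c)) f"
  using S unfolding is_inverse_def diff_Suc_1 by blast

lemma inverse_functional: "Wk a b k f \<Longrightarrow> B (S f c) = c"
  using S unfolding is_inverse_def diff_Suc_1 by blast

lemma inverse_bound: "\<exists>C\<ge>0. \<forall>f c. Wk a b k f \<longrightarrow> wnorm a b (Suc k) (S f c) \<le> C * (wnorm a b k f + norm c)"
proof -
  obtain C where C: "\<forall>f c. Wk a b k f \<longrightarrow> wnorm a b (Suc k) (S f c) \<le> C * (wnorm a b k f + norm c)"
    using S unfolding is_inverse_def diff_Suc_1 by blast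
  have "wnorm a b (Suc k) (S f c) \<le> \<bar>C\<bar> * (wnorm a b k f + norm c)" if "Wk a b k f" for f c
    using C that mult_right_mono [OF abs_ge_self [of C], of "wnorm a b k f + norm c"] wnorm_nonneg [OF that]
    by (meson add_nonneg_nonneg norm_ge_zero order_trans)
  then show ?thesis
    by (intro exI [of _ "\<bar>C\<bar>"]) simp
qed

end

text \<open>Solvability for one set of data, so that an inverse can be assembled afterwards by
  choosing solutions. Functions are compared almost everywhere, boundary values exactly.\<close>

definition solution :: "nat \<Rightarrow> (real \<Rightarrow> complex ^ 'm ^ 'm) \<Rightarrow> ((real \<Rightarrow> complex ^ 'm) \<Rightarrow> complex ^ 'm) \<Rightarrow>
    (real \<Rightarrow> complex ^ 'm) \<Rightarrow> complex ^ 'm \<Rightarrow> (real \<Rightarrow> complex ^ 'm) \<Rightarrow> bool" where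
  "solution k A B f c y \<longleftrightarrow> Wk a b (Suc k) y \<and> aeq a b (Lop a b A y) f \<and> B y = c"

lemma inverse_solution: "is_inverse a b (Suc k) A B S \<Longrightarrow> Wk a b k f \<Longrightarrow> solution k A B f c (S f c)"
  unfolding solution_def using inverse_Wk inverse_Lop inverse_functional by blast

lemma solution_inverse:
  assumes "is_inverse a b (Suc k) A B S" "\<And>j. Wk a b k (\<lambda>x. column j (A x))" "solution k A B f c y"
  shows "aeq a b y (S f c)"
proof -
  have y: "Wk a b (Suc k) y" "aeq a b (Lop a b A y) f" "B y = c"
    using assms(3) unfolding solution_def by auto
  show ?thesis
    using aeq_trans [OF aeq_sym [OF inverse_left [OF assms(1) y(1)]]]
      inverse_aeq [OF assms(1) Lop_Wk [OF assms(2) y(1)] y(2)] y(3) by blast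
qed

text \<open>The a priori bound, applied to a difference, gives uniqueness up to null sets.
  Uniqueness makes the chosen solutions linear in the data and compatible with a.e. equality,
  however the choice is made.\<close>

lemma is_inverse_some_solution:
  assumes A: "\<And>j. Wk a b k (\<lambda>x. column j (A x :: complex ^ 'm ^ 'm))" and B: "bdd_lin_B a b (Suc k) B"
    and ex: "\<And>f c. Wk a b k f \<Longrightarrow> \<exists>y. solution k A B f c y"
    and bound: "\<And>y. Wk a b (Suc k) y \<Longrightarrow> wnorm a b (Suc k) y \<le> C * (wnorm a b k (Lop a b A y) + norm (B y))"
  shows "is_inverse a b (Suc k) A B (\<lambda>f c. SOME y. solution k A B f c y)"
proof -
  define S where "S = (\<lambda>f c. SOME y. solution k A B f c y)"
  have S: "Wk a b (Suc k) (S f c)" "aeq a b (Lop a b A (S f c)) f" "B (S f c) = c" if "Wk a b k f" for f c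
  proof -
    have "solution k A B f c (S f c)"
      unfolding S_def by (rule someI_ex [OF ex [OF that]])
    then show "Wk a b (Suc k) (S f c)" "aeq a b (Lop a b A (S f c)) f" "B (S f c) = c"
      unfolding solution_def by auto
  qed
  have unique: "aeq a b y z"
    if y: "Wk a b (Suc k) y" and z: "Wk a b (Suc k) z" and L: "aeq a b (Lop a b A y) (Lop a b A z)" and "B y = B z" for y z
  proof -
    have d: "Wk a b (Suc k) (\<lambda>x. y x - z x)"
      by (intro Wk_diff y z)
    have "aeq a b (Lop a b A (\<lambda>x. y x - z x)) (\<lambda>x. 0)"
      using Lop_diff [OF y z, of A] L unfolding aeq_def by eventually_elim simp
    then have "wnorm a b k (Lop a b A (\<lambda>x. y x - z x)) = 0"
      by (simp only: wnorm_aeq wnorm_zero)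
    then have "wnorm a b (Suc k) (\<lambda>x. y x - z x) \<le> 0"
      using bound [OF d] functional_diff [OF B y z] \<open>B y = B z\<close> by simp
    then have "aeq a b (\<lambda>x. y x - z x) (\<lambda>x. 0)"
      by (rule wnorm_eq_0_imp [OF d])
    then show ?thesis
      unfolding aeq_def by eventually_elim simp
  qed
  show ?thesis
    unfolding is_inverse_def diff_Suc_1 S_def [symmetric]
  proof (intro conjI allI impI)
    fix f g :: "real \<Rightarrow> complex ^ 'm" and c d \<alpha>
    assume f: "Wk a b k f"
    show "Wk a b (Suc k) (S f c)" "aeq a b (Lop a b A (S f c)) f" "B (S f c) = c"
      using S [OF f] by auto
    assume g: "Wk a b k g"
    show "aeq a b (S f c) (S g c)" if fg: "aeq a b f g"
      by (rule unique [OF S(1) [OF f] S(1) [OF g] aeq_trans [OF S(2) [OF f] aeq_trans [OF fg aeq_sym [OF S(2) [OF g]]]]])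
        (simp only: S(3) [OF f] S(3) [OF g])
    let ?h = "\<lambda>x. \<alpha> *s f x + g x" and ?y = "\<lambda>x. \<alpha> *s S f c x + S g d x"
    have h: "Wk a b k ?h" and y: "Wk a b (Suc k) ?y"
      using Wk_smult_add [OF f g] Wk_smult_add [OF S(1) [OF f] S(1) [OF g]] by blast+
    have "aeq a b (Lop a b A ?y) ?h"
      using Lop_smult_add [OF S(1) [OF f] S(1) [OF g], of A \<alpha> c d] S(2) [OF f, of c] S(2) [OF g, of d]
      unfolding aeq_def by eventually_elim simp
    then have "aeq a b (Lop a b A (S ?h (\<alpha> *s c + d))) (Lop a b A ?y)"
      by (rule aeq_trans [OF S(2) [OF h] aeq_sym])
    then show "aeq a b (S ?h (\<alpha> *s c + d)) ?y"
      by (rule unique [OF S(1) [OF h] y])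
        (simp only: functional_smult_add [OF B S(1) [OF f] S(1) [OF g]] S(3) [OF f] S(3) [OF g] S(3) [OF h])
  next
    have "wnorm a b (Suc k) (S f c) \<le> C * (wnorm a b k f + norm c)" if "Wk a b k f" for f c
      using bound [OF S(1) [OF that, of c]] wnorm_aeq [OF S(2) [OF that, of c]] S(3) [OF that] by simp
    then show "\<exists>C. \<forall>f c. Wk a b k f \<longrightarrow> wnorm a b (Suc k) (S f c) \<le> C * (wnorm a b k f + norm c)"
      by blast
  next
    fix y :: "real \<Rightarrow> complex ^ 'm" assume y: "Wk a b (Suc k) y"
    note Ly = Lop_Wk [OF A y]
    show "aeq a b (S (Lop a b A y) (B y)) y"
      by (rule unique [OF S(1) [OF Ly] y S(2) [OF Ly] S(3) [OF Ly]])
  qed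
qed

text \<open>With \<open>D\<close> and \<open>F\<close> for the perturbations of matrix and
  functional, \<open>d\<close> and \<open>MF\<close> bound them, and \<open>s\<close> bounds
  \<open>F\<close> on the solutions \<open>S (\<lambda>x. 0) v\<close>. Each term of
  \<open>small\<close> contains \<open>d\<close> or \<open>s\<close>, so \<open>MF\<close> may stay
  large. The conclusions are solvability, stability, and an error bound in which the perturbation
  acts only on the unperturbed solution.\<close>

lemma perturbed_inverse:
  fixes A A' :: "real \<Rightarrow> complex ^ 'm ^ 'm"
  assumes A: "\<And>j. Wk a b k (\<lambda>x. column j (A x))" and B: "bdd_lin_B a b (Suc k) B"
    and A': "\<And>j. Wk a b k (\<lambda>x. column j (A' x))" and B': "bdd_lin_B a b (Suc k) B'"
    and S: "is_inverse a b (Suc k) A B S"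
    and CS: "0 \<le> CS" "\<And>f c. Wk a b k f \<Longrightarrow> wnorm a b (Suc k) (S f c) \<le> CS * (wnorm a b k f + norm c)"
    and d: "0 \<le> d" "\<And>y. Wk a b (Suc k) y \<Longrightarrow> wnorm a b k (\<lambda>x. (A' x - A x) *v y x) \<le> d * wnorm a b (Suc k) y"
    and MF: "0 \<le> MF" "\<And>y. Wk a b (Suc k) y \<Longrightarrow> norm (B' y - B y) \<le> MF * wnorm a b (Suc k) y"
    and s: "0 \<le> s" "\<And>v. norm (B' (S (\<lambda>x. 0) v) - B (S (\<lambda>x. 0) v)) \<le> s * norm v"
    and M: "CS * (d + MF) \<le> M"
    and small: "CS * (d * M + (MF * (CS * d) + s * MF)) \<le> 1 / 4"
  shows "\<And>f c. Wk a b k f \<Longrightarrow> \<exists>y. solution k A' B' f c y"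
    and "\<And>y. Wk a b (Suc k) y \<Longrightarrow>
      wnorm a b (Suc k) y \<le> 4 / 3 * (1 + M) * (CS * (wnorm a b k (Lop a b A' y) + norm (B' y)))"
    and "\<And>f c y. Wk a b k f \<Longrightarrow> solution k A' B' f c y \<Longrightarrow> wnorm a b (Suc k) (\<lambda>x. y x - S f c x) \<le>
      4 / 3 * (1 + M) * (CS * (wnorm a b k (\<lambda>x. Lop a b A' (S f c) x - Lop a b A (S f c) x) + norm (B' (S f c) - B (S f c))))"
proof -
  define D where "D y = (\<lambda>x. (A' x - A x) *v y x)" for y :: "real \<Rightarrow> complex ^ 'm"
  define F where "F y = B' y - B y" for y
  define K where "K y = S (D y) (F y)" for y
  have Lop': "Lop a b A' y = (\<lambda>x. Lop a b A y x + D y x)" for y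
    unfolding D_def using Lop_perturb by blast
  have DW: "Wk a b k (D y)" if "Wk a b (Suc k) y" for y
    using Wk_diff [OF Lop_Wk [OF A' that] Lop_Wk [OF A that]] by (simp add: Lop')
  note SW = inverse_Wk [OF S]
  have F_add: "F (\<lambda>x. y x + z x) = F y + F z" and F_diff: "F (\<lambda>x. y x - z x) = F y - F z"
    if "Wk a b (Suc k) y" "Wk a b (Suc k) z" for y z
    using functional_add [OF B that] functional_add [OF B' that] functional_diff [OF B that] functional_diff [OF B' that]
    by (simp_all add: F_def)
  have F_aeq: "F y = F z" if "Wk a b (Suc k) y" "aeq a b y z" for y z
    using functional_aeq [OF B that] functional_aeq [OF B' that] by (simp add: F_def)
  have KW: "Wk a b (Suc k) (K y)" if "Wk a b (Suc k) y" for y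
    unfolding K_def by (intro SW DW that)
  have K_lin: "aeq a b (K (\<lambda>x. y x - z x)) (\<lambda>x. K y x - K z x)"
    if "Wk a b (Suc k) y" "Wk a b (Suc k) z" for y z
  proof -
    have "D (\<lambda>x. y x - z x) = (\<lambda>x. D y x - D z x)"
      by (simp add: D_def matrix_vector_mult_diff_distrib)
    then show ?thesis
      unfolding K_def F_diff [OF that] using inverse_diff [OF S DW [OF that(1)] DW [OF that(2)]] by simp
  qed
  have K_bd: "wnorm a b (Suc k) (K y) \<le> CS * (wnorm a b k (D y) + norm (F y))" if "Wk a b (Suc k) y" for y
    unfolding K_def by (rule CS(2) [OF DW [OF that]])
  have "0 \<le> CS * (d + MF)"
    using CS d MF by simp
  then have M0: "0 \<le> M"
    using M by linarith
  have K_M: "wnorm a b (Suc k) (K y) \<le> M * wnorm a b (Suc k) y" if y: "Wk a b (Suc k) y" for y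
  proof -
    have "CS * (wnorm a b k (D y) + norm (F y)) \<le> CS * ((d + MF) * wnorm a b (Suc k) y)"
      using d(2) [OF y] MF(2) [OF y] CS(1) unfolding D_def F_def by (intro mult_left_mono) (simp_all add: algebra_simps)
    also have "\<dots> \<le> M * wnorm a b (Suc k) y"
      using mult_right_mono [OF M wnorm_nonneg [OF y]] by (simp add: mult.assoc)
    finally show ?thesis
      using K_bd [OF y] by linarith
  qed
  have K_K: "wnorm a b (Suc k) (K (K y)) \<le> wnorm a b (Suc k) y / 4" if y: "Wk a b (Suc k) y" for y
  proof -
    let ?n = "wnorm a b (Suc k) y"
    have n: "0 \<le> ?n"
      by (rule wnorm_nonneg [OF y])
    have Sy: "Wk a b (Suc k) (S (D y) 0)" and S0: "Wk a b (Suc k) (S (\<lambda>x. 0) (F y))"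
      by (intro SW DW y Wk_const)+
    \<comment> \<open>Splitting the data separates two reasons why \<open>F (K y)\<close> is small:
      the factor \<open>d\<close> in the first part, and the bound \<open>s\<close> on solutions
      with zero right-hand side in the second.\<close>
    have "aeq a b (K y) (\<lambda>x. S (D y) 0 x + S (\<lambda>x. 0) (F y) x)"
      using inverse_add [OF S DW [OF y] Wk_const [of k 0], of 0 "F y"] by (simp add: K_def)
    then have "F (K y) = F (S (D y) 0) + F (S (\<lambda>x. 0) (F y))"
      using F_aeq [OF KW [OF y]] F_add [OF Sy S0] by simp
    moreover have "norm (F (S (D y) 0)) \<le> MF * (CS * (d * ?n))"
    proof -
      have "wnorm a b (Suc k) (S (D y) 0) \<le> CS * (d * ?n)"
        using CS(2) [OF DW [OF y], of 0] mult_left_mono [OF d(2) [OF y] CS(1)] by (simp add: D_def)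
      then show ?thesis
        using MF(2) [OF Sy] mult_left_mono [OF _ MF(1)] unfolding F_def by (meson order_trans)
    qed
    moreover have "norm (F (S (\<lambda>x. 0) (F y))) \<le> s * (MF * ?n)"
      using s(2) [of "F y"] mult_left_mono [OF MF(2) [OF y] s(1)] unfolding F_def by linarith
    ultimately have "norm (F (K y)) \<le> MF * (CS * (d * ?n)) + s * (MF * ?n)"
      by (simp add: norm_triangle_mono)
    moreover have "wnorm a b k (D (K y)) \<le> d * (M * ?n)"
      using d(2) [OF KW [OF y]] mult_left_mono [OF K_M [OF y] d(1)] unfolding D_def by linarith
    ultimately have "wnorm a b k (D (K y)) + norm (F (K y)) \<le> (d * M + (MF * (CS * d) + s * MF)) * ?n"
      by (simp add: algebra_simps)
    then have "CS * (wnorm a b k (D (K y)) + norm (F (K y))) \<le> CS * ((d * M + (MF * (CS * d) + s * MF)) * ?n)"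
      by (rule mult_left_mono [OF _ CS(1)])
    also have "\<dots> = CS * (d * M + (MF * (CS * d) + s * MF)) * ?n"
      by simp
    also have "\<dots> \<le> 1 / 4 * ?n"
      by (rule mult_right_mono [OF small n])
    finally show ?thesis
      using K_bd [OF KW [OF y]] by linarith
  qed
  have N: "Wk a b (Suc k) f \<Longrightarrow> \<exists>y. Wk a b (Suc k) y \<and> aeq a b (\<lambda>x. y x + K y x) f"
    "Wk a b (Suc k) f \<Longrightarrow> wnorm a b (Suc k) f \<le> 4 / 3 * (1 + M) * wnorm a b (Suc k) (\<lambda>x. f x + K f x)" for f
    by (rule neumann_series [where K = K, OF KW K_lin M0 K_M K_K], assumption+)+
  \<comment> \<open>The perturbed data of \<open>y\<close> are the old data plus \<open>D y\<close>
    and \<open>F y\<close>, so applying \<open>S\<close> produces \<open>y + K y\<close>.\<close>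
  have T: "aeq a b (S (Lop a b A' y) (B' y)) (\<lambda>x. y x + K y x)" if y: "Wk a b (Suc k) y" for y
  proof -
    have "B' y = B y + F y"
      by (simp add: F_def)
    then have "aeq a b (S (Lop a b A' y) (B' y)) (\<lambda>x. S (Lop a b A y) (B y) x + K y x)"
      using inverse_add [OF S Lop_Wk [OF A y] DW [OF y]] unfolding K_def Lop' by simp
    then show ?thesis
      using inverse_left [OF S y] unfolding aeq_def by eventually_elim simp
  qed
  show "\<exists>y. solution k A' B' f c y" if f: "Wk a b k f" for f c
  proof -
    obtain y where y: "Wk a b (Suc k) y" "aeq a b (\<lambda>x. y x + K y x) (S f c)"
      using N(1) [OF SW [OF f]] by blast
    have Ly: "Wk a b k (Lop a b A' y)"
      by (rule Lop_Wk [OF A' y(1)])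
    have eq: "aeq a b (S (Lop a b A' y) (B' y)) (S f c)"
      by (rule aeq_trans [OF T [OF y(1)] y(2)])
    \<comment> \<open>Both sides of \<open>eq\<close> are values of \<open>S\<close>, and the
      unperturbed operator and functional recover the data from them.\<close>
    have "B' y = c"
      using functional_aeq [OF B SW [OF Ly] eq] inverse_functional [OF S] Ly f by simp
    moreover have "aeq a b (Lop a b A' y) f"
      using aeq_trans [OF aeq_sym [OF inverse_Lop [OF S Ly]] aeq_trans [OF Lop_aeq [OF SW [OF Ly] eq] inverse_Lop [OF S f]]] .
    ultimately show ?thesis
      unfolding solution_def using y(1) by blast
  qed
  show "wnorm a b (Suc k) y \<le> 4 / 3 * (1 + M) * (CS * (wnorm a b k (Lop a b A' y) + norm (B' y)))"
    if y: "Wk a b (Suc k) y" for y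
  proof -
    have "wnorm a b (Suc k) (\<lambda>x. y x + K y x) \<le> CS * (wnorm a b k (Lop a b A' y) + norm (B' y))"
      using CS(2) [OF Lop_Wk [OF A' y], of "B' y"] by (simp only: wnorm_aeq [OF T [OF y]])
    then show ?thesis
      using N(2) [OF y] M0 by (meson mult_left_mono order_trans add_nonneg_nonneg mult_nonneg_nonneg zero_le_one zero_le_divide_iff zero_le_numeral)
  qed
  show "wnorm a b (Suc k) (\<lambda>x. y x - S f c x) \<le>
      4 / 3 * (1 + M) * (CS * (wnorm a b k (\<lambda>x. Lop a b A' (S f c) x - Lop a b A (S f c) x) + norm (B' (S f c) - B (S f c))))"
    if f: "Wk a b k f" and sol: "solution k A' B' f c y" for f c y
  proof -
    have y: "Wk a b (Suc k) y" "aeq a b (Lop a b A' y) f" "B' y = c"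
      using sol unfolding solution_def by auto
    let ?z = "S f c" and ?w = "\<lambda>x. y x - S f c x"
    note z = SW [OF f, of c]
    have w: "Wk a b (Suc k) ?w"
      by (intro Wk_diff y z)
    have "aeq a b (S (Lop a b A' y) (B' y)) ?z"
      using inverse_aeq [OF S Lop_Wk [OF A' y(1)] y(2)] y(3) by simp
    \<comment> \<open>From \<open>y + K y = ?z\<close> follows \<open>?w + K ?w = - K ?z\<close>.
      The right side involves only the fixed function \<open>?z\<close>, so strong convergence is
      enough to make it small.\<close>
    then have "aeq a b (\<lambda>x. ?w x + K ?w x) (\<lambda>x. - K ?z x)"
      using T [OF y(1)] K_lin [OF y(1) z] unfolding aeq_def by eventually_elim (simp add: algebra_simps)
    then have "wnorm a b (Suc k) (\<lambda>x. ?w x + K ?w x) = wnorm a b (Suc k) (K ?z)"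
      using wnorm_aeq wnorm_minus [OF KW [OF z]] by metis
    also have "\<dots> \<le> CS * (wnorm a b k (D ?z) + norm (F ?z))"
      by (rule K_bd [OF z])
    finally have "wnorm a b (Suc k) ?w \<le> 4 / 3 * (1 + M) * (CS * (wnorm a b k (D ?z) + norm (F ?z)))"
      using N(2) [OF w] M0 by (meson mult_left_mono order_trans add_nonneg_nonneg mult_nonneg_nonneg zero_le_one zero_le_divide_iff zero_le_numeral)
    then show ?thesis
      by (simp add: Lop' F_def)
  qed
qed

subsection \<open>Convergence of operators and of inverses\<close>

lemma Wk_column_diff:
  fixes A A' :: "real \<Rightarrow> complex ^ 'm ^ 'm"
  assumes "\<And>j. Wk a b k (\<lambda>x. column j (A x))" "\<And>j. Wk a b k (\<lambda>x. column j (A' x))"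
  shows "Wk a b k (\<lambda>x. column j (A' x - A x))"
proof -
  have "(\<lambda>x. column j (A' x - A x)) = (\<lambda>x. column j (A' x) - column j (A x))"
    by (simp add: column_def vec_eq_iff fun_eq_iff)
  then show ?thesis
    using Wk_diff [OF assms(2,1)] by simp
qed

lemma Lop_diff_axis:
  "(\<lambda>x. Lop a b A' (\<lambda>x. axis j 1) x - Lop a b A (\<lambda>x. axis j 1) x) = (\<lambda>x. column j (A' x - A x :: complex ^ 'm ^ 'm))"
  by (simp add: Lop_perturb [of A' _ _ A] matrix_vector_axis)

lemma strong_convergence_imp_inverses_converge:
  fixes A :: "real \<Rightarrow> real \<Rightarrow> complex ^ 'm ^ 'm"
  assumes "0 < \<epsilon>0"
    and A: "\<And>e j. 0 \<le> e \<Longrightarrow> e < \<epsilon>0 \<Longrightarrow> Wk a b k (\<lambda>x. column j (A e x))"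
    and B: "\<And>e. 0 \<le> e \<Longrightarrow> e < \<epsilon>0 \<Longrightarrow> bdd_lin_B a b (Suc k) (B e)"
    and S0: "is_inverse a b (Suc k) (A 0) (B 0) S0"
    and limL: "\<And>y. Wk a b (Suc k) y \<Longrightarrow>
      ((\<lambda>e. wnorm a b k (\<lambda>x. Lop a b (A e) y x - Lop a b (A 0) y x)) \<longlongrightarrow> 0) (at_right 0)"
    and limB: "\<And>y. Wk a b (Suc k) y \<Longrightarrow> ((\<lambda>e. B e y) \<longlongrightarrow> B 0 y) (at_right 0)"
  shows "\<exists>\<delta>>0. \<exists>S. (\<forall>e\<in>{0..<min \<delta> \<epsilon>0}. is_inverse a b (Suc k) (A e) (B e) (S e)) \<and>
    (\<forall>f c. Wk a b k f \<longrightarrow> ((\<lambda>e. wnorm a b (Suc k) (\<lambda>x. S e f c x - S 0 f c x)) \<longlongrightarrow> 0) (at_right 0))"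
proof -
  note A0 = A [OF order_refl \<open>0 < \<epsilon>0\<close>] and B0 = B [OF order_refl \<open>0 < \<epsilon>0\<close>]
  define D where "D e x = A e x - A 0 x" for e x
  have DW: "Wk a b k (\<lambda>x. column j (D e x))" if "0 \<le> e" "e < \<epsilon>0" for e j
    unfolding D_def by (intro Wk_column_diff A A0 that)
  obtain cm where cm: "0 \<le> cm" "\<forall>(A :: real \<Rightarrow> complex ^ 'm ^ 'm) y. (\<forall>j. Wk a b k (\<lambda>x. column j (A x))) \<longrightarrow> Wk a b k y \<longrightarrow>
     Wk a b k (\<lambda>x. A x *v y x) \<and> wnorm a b k (\<lambda>x. A x *v y x) \<le> cm * matnorm k A * wnorm a b k y"
    using Wk_matrix_vector [of k, where 'm = 'm] by blast
  obtain CS where CS: "0 \<le> CS" "\<And>f c. Wk a b k f \<Longrightarrow> wnorm a b (Suc k) (S0 f c) \<le> CS * (wnorm a b k f + norm c)"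
    using inverse_bound [OF S0] by blast
  obtain CB where CB: "0 \<le> CB" "\<And>y. Wk a b (Suc k) y \<Longrightarrow> norm (B 0 y) \<le> CB * wnorm a b (Suc k) y"
    using functional_bound [OF B0] by blast
  \<comment> \<open>Banach-Steinhaus for the boundary functionals; their strong convergence provides
    the pointwise bounds.\<close>
  have "\<exists>\<delta>>0. \<exists>M\<ge>0. \<forall>e y. 0 < e \<longrightarrow> e < \<delta> \<longrightarrow> Wk a b (Suc k) y \<longrightarrow> norm (B e y) \<le> M * wnorm a b (Suc k) y"
  proof (rule uniform_boundedness [OF \<open>0 < \<epsilon>0\<close>])
    fix e c and y z :: "real \<Rightarrow> complex ^ 'm" assume e: "0 < e" "e < \<epsilon>0" and y: "Wk a b (Suc k) y"
    have Be: "bdd_lin_B a b (Suc k) (B e)"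
      using B e by simp
    show "norm (B e (\<lambda>x. c *s y x)) \<le> cmod c * norm (B e y)"
      using functional_smult [OF Be y] by (simp add: norm_vector_smult)
    assume z: "Wk a b (Suc k) z"
    show "norm (B e (\<lambda>x. y x + z x)) \<le> norm (B e y) + norm (B e z)"
      using functional_add [OF Be y z] by (simp add: norm_triangle_ineq)
  next
    fix e assume e: "0 < e" "e < \<epsilon>0"
    then show "\<exists>C. \<forall>y. Wk a b (Suc k) y \<longrightarrow> norm (B e y) \<le> C * wnorm a b (Suc k) y"
      using functional_bound [OF B [of e]] by (meson less_imp_le)
  next
    fix y :: "real \<Rightarrow> complex ^ 'm" assume y: "Wk a b (Suc k) y"
    have "\<forall>\<^sub>F e in at_right 0. norm (B e y) < norm (B 0 y) + 1"
      using tendsto_norm [OF limB [OF y]] by (rule order_tendstoD) simp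
    then show "\<exists>C. \<forall>\<^sub>F e in at_right 0. norm (B e y) \<le> C"
      by (meson eventually_mono less_imp_le)
  qed
  then obtain \<delta>1 MB where MB: "0 < \<delta>1" "0 \<le> MB"
    "\<And>e y. 0 < e \<Longrightarrow> e < \<delta>1 \<Longrightarrow> Wk a b (Suc k) y \<Longrightarrow> norm (B e y) \<le> MB * wnorm a b (Suc k) y"
    by blast
  \<comment> \<open>\<open>MF\<close> will bound \<open>B e - B 0\<close> without being small. The 1
    in \<open>M\<close> stands for an eventual bound of \<open>d e\<close>, which keeps
    \<open>M\<close> independent of \<open>e\<close>. \<open>\<kappa> e\<close> bounds the squared
    perturbation and tends to 0 with \<open>d e\<close> and \<open>s e\<close>.\<close>
  define MF where "MF = MB + CB"
  define d where "d e = cm * matnorm k (D e)" for e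
  define s where "s e = (\<Sum>j\<in>UNIV. norm (B e (S0 (\<lambda>x. 0) (axis j 1)) - B 0 (S0 (\<lambda>x. 0) (axis j 1))))" for e
  define M where "M = CS * (1 + MF)"
  define \<kappa> where "\<kappa> e = CS * (d e * M + (MF * (CS * d e) + s e * MF))" for e
  \<comment> \<open>On the constants \<open>axis j 1\<close> strong convergence of the operators is
    convergence of the columns.\<close>
  have "((\<lambda>e. wnorm a b k (\<lambda>x. column j (D e x))) \<longlongrightarrow> 0) (at_right 0)" for j
    using limL [OF Wk_const [of "Suc k" "axis j 1"]] unfolding D_def Lop_diff_axis .
  then have "((\<lambda>e. matnorm k (D e)) \<longlongrightarrow> 0) (at_right 0)"
    unfolding matnorm_def by (intro tendsto_null_sum)
  then have limd: "(d \<longlongrightarrow> 0) (at_right 0)"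
    unfolding d_def using tendsto_mult_left [of _ 0 _ cm] by simp
  have "((\<lambda>e. norm (B e y - B 0 y)) \<longlongrightarrow> 0) (at_right 0)" if "Wk a b (Suc k) y" for y
    using limB [OF that] by (intro tendsto_norm_zero) (simp add: LIM_zero_iff)
  then have lims: "(s \<longlongrightarrow> 0) (at_right 0)"
    unfolding s_def by (intro tendsto_null_sum) (blast intro: inverse_Wk [OF S0] Wk_const)
  have "(\<kappa> \<longlongrightarrow> CS * (0 * M + (MF * (CS * 0) + 0 * MF))) (at_right 0)"
    unfolding \<kappa>_def by (intro tendsto_intros limd lims)
  then have "\<forall>\<^sub>F e in at_right 0. \<kappa> e < 1 / 4"
    by (rule order_tendstoD) simp
  moreover have "\<forall>\<^sub>F e in at_right 0. d e < 1"
    using limd by (rule order_tendstoD) simp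
  ultimately have "\<forall>\<^sub>F e in at_right 0. \<kappa> e < 1 / 4 \<and> d e < 1 \<and> (0 < e \<and> e < \<delta>1)"
    by (intro eventually_conj eventually_at_right_0 MB(1))
  then obtain \<delta> where \<delta>: "0 < \<delta>" "\<And>e. 0 < e \<Longrightarrow> e < \<delta> \<Longrightarrow> \<kappa> e < 1 / 4 \<and> d e < 1 \<and> e < \<delta>1"
    unfolding eventually_at_right_field by auto
  have MF: "0 \<le> MF" "0 \<le> M"
    using MB CB CS by (simp_all add: MF_def M_def)
  have good:
    "\<And>f c. Wk a b k f \<Longrightarrow> \<exists>y. solution k (A e) (B e) f c y"
    "\<And>y. Wk a b (Suc k) y \<Longrightarrow>
      wnorm a b (Suc k) y \<le> 4 / 3 * (1 + M) * (CS * (wnorm a b k (Lop a b (A e) y) + norm (B e y)))"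
    "\<And>f c y. Wk a b k f \<Longrightarrow> solution k (A e) (B e) f c y \<Longrightarrow> wnorm a b (Suc k) (\<lambda>x. y x - S0 f c x) \<le>
      4 / 3 * (1 + M) * (CS * (wnorm a b k (\<lambda>x. Lop a b (A e) (S0 f c) x - Lop a b (A 0) (S0 f c) x) + norm (B e (S0 f c) - B 0 (S0 f c))))"
    if e: "0 < e" "e < \<delta>" "e < \<epsilon>0" for e
  proof -
    have e0: "0 \<le> e"
      using e by simp
    note Be = B [OF e0 e(3)]
    have m: "0 \<le> matnorm k (D e)"
      unfolding matnorm_def by (intro sum_nonneg wnorm_nonneg DW e0 e(3))
    have d0: "0 \<le> d e"
      using cm m by (simp add: d_def)
    have dy: "wnorm a b k (\<lambda>x. (A e x - A 0 x) *v y x) \<le> d e * wnorm a b (Suc k) y" if y: "Wk a b (Suc k) y" for y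
    proof -
      have "wnorm a b k (\<lambda>x. D e x *v y x) \<le> d e * wnorm a b k y"
        using cm(2) DW [OF e0 e(3)] Wk_Suc_imp [OF y] unfolding d_def by blast
      then show ?thesis
        using mult_left_mono [OF wnorm_le_Suc [OF y] d0] unfolding D_def by linarith
    qed
    have Fy: "norm (B e y - B 0 y) \<le> MF * wnorm a b (Suc k) y" if y: "Wk a b (Suc k) y" for y
      using norm_triangle_ineq4 [of "B e y" "B 0 y"] MB(3) [OF e(1) _ y] \<delta>(2) [OF e(1,2)] CB(2) [OF y]
      by (simp add: MF_def algebra_simps)
    have s0: "0 \<le> s e"
      unfolding s_def by (intro sum_nonneg) simp
    have Z: "Wk a b (Suc k) (S0 (\<lambda>x. 0) v)" for v
      by (intro inverse_Wk [OF S0] Wk_const)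
    \<comment> \<open>The solutions with zero right-hand side depend linearly on \<open>v\<close>,
      so the values at the basis vectors, summed in \<open>s e\<close>, bound the whole map.\<close>
    have sv: "norm (B e (S0 (\<lambda>x. 0) v) - B 0 (S0 (\<lambda>x. 0) v)) \<le> s e * norm v" for v
      unfolding s_def
    proof (rule complex_linear_bound [of "\<lambda>v. B e (S0 (\<lambda>x. 0) v) - B 0 (S0 (\<lambda>x. 0) v)"])
      fix c v w
      have lin: "B' (S0 (\<lambda>x. 0) (c *s v + w)) = c *s B' (S0 (\<lambda>x. 0) v) + B' (S0 (\<lambda>x. 0) w)"
        if "bdd_lin_B a b (Suc k) B'" for B'
        using functional_aeq [OF that Z inverse_smult_add_0 [OF S0]] functional_smult_add [OF that Z Z] by simp
      show "B e (S0 (\<lambda>x. 0) (c *s v + w)) - B 0 (S0 (\<lambda>x. 0) (c *s v + w)) =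
          c *s (B e (S0 (\<lambda>x. 0) v) - B 0 (S0 (\<lambda>x. 0) v)) + (B e (S0 (\<lambda>x. 0) w) - B 0 (S0 (\<lambda>x. 0) w))"
        by (simp add: lin [OF Be] lin [OF B0] vector_ssub_ldistrib)
    qed
    have M: "CS * (d e + MF) \<le> M"
      unfolding M_def using \<delta>(2) [OF e(1,2)] CS(1) by (intro mult_left_mono) simp_all
    have small: "CS * (d e * M + (MF * (CS * d e) + s e * MF)) \<le> 1 / 4"
      using \<delta>(2) [OF e(1,2)] unfolding \<kappa>_def by simp
    note P = perturbed_inverse [OF A0 B0 A [OF e0 e(3)] Be S0 CS d0 dy MF(1) Fy s0 sv M small]
    show "\<And>f c. Wk a b k f \<Longrightarrow> \<exists>y. solution k (A e) (B e) f c y"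
      by (rule P(1))
    show "\<And>y. Wk a b (Suc k) y \<Longrightarrow>
        wnorm a b (Suc k) y \<le> 4 / 3 * (1 + M) * (CS * (wnorm a b k (Lop a b (A e) y) + norm (B e y)))"
      by (rule P(2))
    show "\<And>f c y. Wk a b k f \<Longrightarrow> solution k (A e) (B e) f c y \<Longrightarrow> wnorm a b (Suc k) (\<lambda>x. y x - S0 f c x) \<le>
        4 / 3 * (1 + M) * (CS * (wnorm a b k (\<lambda>x. Lop a b (A e) (S0 f c) x - Lop a b (A 0) (S0 f c) x) + norm (B e (S0 f c) - B 0 (S0 f c))))"
      by (rule P(3))
  qed
  \<comment> \<open>One rule of choice serves all parameters, 0 included; at 0 its values agree with
    those of \<open>S0\<close> up to null sets.\<close>
  define S where "S e = (\<lambda>f c. SOME y. solution k (A e) (B e) f c y)" for e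
  have inv: "is_inverse a b (Suc k) (A e) (B e) (S e)" if "0 \<le> e" "e < \<delta>" "e < \<epsilon>0" for e
  proof (cases "e = 0")
    case True
    \<comment> \<open>At parameter 0 the stability estimate is the boundedness of \<open>S0\<close>,
      applied to the data of \<open>y\<close>.\<close>
    have "wnorm a b (Suc k) y \<le> CS * (wnorm a b k (Lop a b (A 0) y) + norm (B 0 y))" if y: "Wk a b (Suc k) y" for y
      using CS(2) [OF Lop_Wk [OF A0 y], of "B 0 y"] by (simp only: wnorm_aeq [OF inverse_left [OF S0 y]])
    then show ?thesis
      unfolding True S_def using is_inverse_some_solution [OF A0 B0] inverse_solution [OF S0] by blast
  next
    case False
    then have e: "0 < e"
      using that by simp
    show ?thesis
      unfolding S_def
      by (rule is_inverse_some_solution [where C = "4 / 3 * (1 + M) * CS", OF A [OF that(1,3)] B [OF that(1,3)] good(1) [OF e that(2,3)]])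
        (use good(2) [OF e that(2,3)] in \<open>auto simp: mult.assoc\<close>)
  qed
  have lim: "((\<lambda>e. wnorm a b (Suc k) (\<lambda>x. S e f c x - S 0 f c x)) \<longlongrightarrow> 0) (at_right 0)" if f: "Wk a b k f" for f c
  proof (rule Lim_null_comparison)
    let ?g = "\<lambda>e. 4 / 3 * (1 + M) * (CS * (wnorm a b k (\<lambda>x. Lop a b (A e) (S0 f c) x - Lop a b (A 0) (S0 f c) x) + norm (B e (S0 f c) - B 0 (S0 f c))))"
    note z = inverse_Wk [OF S0 f, of c]
    have "(?g \<longlongrightarrow> 4 / 3 * (1 + M) * (CS * (0 + norm (B 0 (S0 f c) - B 0 (S0 f c))))) (at_right 0)"
      by (intro tendsto_intros limL limB z)
    then show "(?g \<longlongrightarrow> 0) (at_right 0)"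
      by simp
    have "aeq a b (S 0 f c) (S0 f c)"
      by (rule solution_inverse [OF S0 A0 inverse_solution [OF inv f]]) (use \<delta>(1) \<open>0 < \<epsilon>0\<close> in auto)
    have "norm (wnorm a b (Suc k) (\<lambda>x. S e f c x - S 0 f c x)) \<le> ?g e" if e: "0 < e \<and> e < min \<delta> \<epsilon>0" for e
    proof -
      have ie: "is_inverse a b (Suc k) (A e) (B e) (S e)"
        by (rule inv) (use e in auto)
      have "aeq a b (\<lambda>x. S e f c x - S 0 f c x) (\<lambda>x. S e f c x - S0 f c x)"
        using \<open>aeq a b (S 0 f c) (S0 f c)\<close> unfolding aeq_def by eventually_elim simp
      then have "wnorm a b (Suc k) (\<lambda>x. S e f c x - S 0 f c x) = wnorm a b (Suc k) (\<lambda>x. S e f c x - S0 f c x)"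
        by (rule wnorm_aeq)
      moreover have "wnorm a b (Suc k) (\<lambda>x. S e f c x - S0 f c x) \<le> ?g e"
        by (rule good(3) [OF _ _ _ f inverse_solution [OF ie f]]) (use e in auto)
      moreover have "0 \<le> wnorm a b (Suc k) (\<lambda>x. S e f c x - S0 f c x)"
        by (intro wnorm_nonneg Wk_diff z inverse_Wk [OF ie f])
      ultimately show ?thesis
        by simp
    qed
    then show "\<forall>\<^sub>F e in at_right 0. norm (wnorm a b (Suc k) (\<lambda>x. S e f c x - S 0 f c x)) \<le> ?g e"
      using \<delta>(1) \<open>0 < \<epsilon>0\<close> by (intro eventually_mono [OF eventually_at_right_0 [of "min \<delta> \<epsilon>0"]]) auto
  qed
  show ?thesis
    using \<delta>(1) inv lim by (intro exI [of _ \<delta>] conjI exI [of _ S]) auto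
qed

section \<open>From converging inverses to converging operators\<close>

lemma inverse_zero:
  assumes "is_inverse a b (Suc k) A B S"
  shows "aeq a b (S (\<lambda>x. 0) 0) (\<lambda>x. 0)"
  using inverse_smult_add_0 [OF assms, of 1 0 0] unfolding aeq_def by eventually_elim simp

lemma inverse_smult:
  assumes S: "is_inverse a b (Suc k) A B S" and f: "Wk a b k f"
  shows "aeq a b (S (\<lambda>x. \<alpha> *s f x) (\<alpha> *s c)) (\<lambda>x. \<alpha> *s S f c x)"
proof -
  have "aeq a b (S (\<lambda>x. \<alpha> *s f x) (\<alpha> *s c)) (\<lambda>x. \<alpha> *s S f c x + S (\<lambda>x. 0) 0 x)"
    using inverse_smult_add [OF S f Wk_const [of k 0], of \<alpha> c 0] by simp
  then show ?thesis
    using inverse_zero [OF S] unfolding aeq_def by eventually_elim simp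
qed

lemma inverses_converge_imp_strong_convergence:
  fixes A :: "real \<Rightarrow> real \<Rightarrow> complex ^ 'm ^ 'm"
  assumes "0 < \<delta>"
    and A: "\<And>e j. 0 \<le> e \<Longrightarrow> e < \<delta> \<Longrightarrow> Wk a b k (\<lambda>x. column j (A e x))"
    and B: "\<And>e. 0 \<le> e \<Longrightarrow> e < \<delta> \<Longrightarrow> bdd_lin_B a b (Suc k) (B e)"
    and S: "\<And>e. 0 \<le> e \<Longrightarrow> e < \<delta> \<Longrightarrow> is_inverse a b (Suc k) (A e) (B e) (S e)"
    and limS: "\<And>f c. Wk a b k f \<Longrightarrow> ((\<lambda>e. wnorm a b (Suc k) (\<lambda>x. S e f c x - S 0 f c x)) \<longlongrightarrow> 0) (at_right 0)"
    and y: "Wk a b (Suc k) y"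
  shows "((\<lambda>e. wnorm a b k (\<lambda>x. Lop a b (A e) y x - Lop a b (A 0) y x)) \<longlongrightarrow> 0) (at_right 0)"
    and "((\<lambda>e. B e y) \<longlongrightarrow> B 0 y) (at_right 0)"
proof -
  note A0 = A [OF order_refl \<open>0 < \<delta>\<close>] and B0 = B [OF order_refl \<open>0 < \<delta>\<close>] and S0 = S [OF order_refl \<open>0 < \<delta>\<close>]
  define D where "D e x = A e x - A 0 x" for e x
  have DW: "Wk a b k (\<lambda>x. column j (D e x))" if "0 \<le> e" "e < \<delta>" for e j
    unfolding D_def by (intro Wk_column_diff A A0 that)
  obtain cm where cm: "0 \<le> cm" "\<forall>(A :: real \<Rightarrow> complex ^ 'm ^ 'm) y. (\<forall>j. Wk a b k (\<lambda>x. column j (A x))) \<longrightarrow> Wk a b k y \<longrightarrow>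
     Wk a b k (\<lambda>x. A x *v y x) \<and> wnorm a b k (\<lambda>x. A x *v y x) \<le> cm * matnorm k A * wnorm a b k y"
    using Wk_matrix_vector [of k, where 'm = 'm] by blast
  obtain CL where CL: "0 \<le> CL" "\<And>y. Wk a b (Suc k) y \<Longrightarrow> wnorm a b k (Lop a b (A 0) y) \<le> CL * wnorm a b (Suc k) y"
    using Lop_bound [OF A0] by blast
  obtain CB where CB: "0 \<le> CB" "\<And>y. Wk a b (Suc k) y \<Longrightarrow> norm (B 0 y) \<le> CB * wnorm a b (Suc k) y"
    using functional_bound [OF B0] by blast
  have Dz: "Wk a b k (\<lambda>x. D e x *v z x)" "wnorm a b k (\<lambda>x. D e x *v z x) \<le> cm * matnorm k (D e) * wnorm a b (Suc k) z"
    if e: "0 \<le> e" "e < \<delta>" and z: "Wk a b (Suc k) z" for e z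
  proof -
    have D: "\<forall>j. Wk a b k (\<lambda>x. column j (D e x))"
      using DW [OF e] by blast
    have "0 \<le> cm * matnorm k (D e)"
      unfolding matnorm_def by (intro mult_nonneg_nonneg sum_nonneg wnorm_nonneg cm DW e)
    then have "cm * matnorm k (D e) * wnorm a b k z \<le> cm * matnorm k (D e) * wnorm a b (Suc k) z"
      by (rule mult_left_mono [OF wnorm_le_Suc [OF z]])
    moreover have "Wk a b k (\<lambda>x. D e x *v z x) \<and> wnorm a b k (\<lambda>x. D e x *v z x) \<le> cm * matnorm k (D e) * wnorm a b k z"
      using cm(2) D Wk_Suc_imp [OF z] by blast
    ultimately show "Wk a b k (\<lambda>x. D e x *v z x)" "wnorm a b k (\<lambda>x. D e x *v z x) \<le> cm * matnorm k (D e) * wnorm a b (Suc k) z"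
      by auto
  qed

  \<comment> \<open>First the matrices. \<open>v j e\<close> solves the problem at \<open>e\<close>
    with the data that the constant \<open>u j\<close> has at 0, so it converges to
    \<open>u j\<close>; \<open>t e\<close> collects the errors.\<close>
  define u :: "'m \<Rightarrow> real \<Rightarrow> complex ^ 'm" where "u j = (\<lambda>x. axis j 1)" for j
  have uW: "Wk a b l (u j)" for l j
    unfolding u_def by (rule Wk_const)
  define v where "v j e = S e (Lop a b (A 0) (u j)) (B 0 (u j))" for j e
  have L0u: "Wk a b k (Lop a b (A 0) (u j))" for j
    by (rule Lop_Wk [OF A0 uW])
  have vW: "Wk a b (Suc k) (v j e)" if "0 \<le> e" "e < \<delta>" for j e
    unfolding v_def by (rule inverse_Wk [OF S [OF that] L0u])
  define t where "t e = (\<Sum>j\<in>UNIV. wnorm a b (Suc k) (\<lambda>x. v j e x - u j x))" for e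
  have "((\<lambda>e. wnorm a b (Suc k) (\<lambda>x. v j e x - u j x)) \<longlongrightarrow> 0) (at_right 0)" for j
  proof -
    have "aeq a b (v j 0) (u j)"
      unfolding v_def by (rule inverse_left [OF S0 uW])
    then have "aeq a b (\<lambda>x. v j e x - v j 0 x) (\<lambda>x. v j e x - u j x)" for e
      unfolding aeq_def by eventually_elim simp
    then have "wnorm a b (Suc k) (\<lambda>x. v j e x - v j 0 x) = wnorm a b (Suc k) (\<lambda>x. v j e x - u j x)" for e
      by (rule wnorm_aeq)
    then show ?thesis
      using limS [OF L0u [of j], of "B 0 (u j)"] unfolding v_def by simp
  qed
  then have limt: "(t \<longlongrightarrow> 0) (at_right 0)"
    unfolding t_def by (intro tendsto_null_sum)
  \<comment> \<open>Splitting the operator at \<open>e\<close> into the one at 0 plus multiplication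
    by \<open>D e\<close> puts \<open>matnorm k (D e)\<close> on the right as well, but with the
    vanishing factor \<open>t e\<close>.\<close>
  have mD: "matnorm k (D e) \<le> (CL + cm * matnorm k (D e)) * t e" if e: "0 \<le> e" "e < \<delta>" for e
  proof -
    have "wnorm a b k (\<lambda>x. column j (D e x)) \<le> (CL + cm * matnorm k (D e)) * wnorm a b (Suc k) (\<lambda>x. v j e x - u j x)" for j
    proof -
      let ?E = "\<lambda>x. v j e x - u j x"
      have E: "Wk a b (Suc k) ?E"
        by (intro Wk_diff vW uW e)
      have Lv: "aeq a b (Lop a b (A e) (v j e)) (Lop a b (A 0) (u j))"
        unfolding v_def by (rule inverse_Lop [OF S [OF e] L0u])
      have Lu: "Lop a b (A e) (u j) x = Lop a b (A 0) (u j) x + column j (D e x)" for x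
        by (simp add: Lop_perturb [of "A e" _ _ "A 0"] D_def u_def matrix_vector_axis)
      have "aeq a b (Lop a b (A e) ?E) (\<lambda>x. - column j (D e x))"
        using Lv Lop_diff [OF vW [OF e] uW, of "A e" j j] unfolding aeq_def by eventually_elim (simp add: Lu)
      then have "wnorm a b k (Lop a b (A e) ?E) = wnorm a b k (\<lambda>x. column j (D e x))"
        by (simp only: wnorm_aeq wnorm_minus [OF DW [OF e]])
      moreover have "Lop a b (A e) ?E = (\<lambda>x. Lop a b (A 0) ?E x + D e x *v ?E x)"
        unfolding D_def using Lop_perturb by blast
      moreover have "wnorm a b k (\<lambda>x. Lop a b (A 0) ?E x + D e x *v ?E x) \<le>
          CL * wnorm a b (Suc k) ?E + cm * matnorm k (D e) * wnorm a b (Suc k) ?E"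
        using wnorm_add_le [OF Lop_Wk [OF A0 E] Dz(1) [OF e E]] CL(2) [OF E] Dz(2) [OF e E] by linarith
      ultimately show ?thesis
        by (simp add: distrib_right)
    qed
    then have "matnorm k (D e) \<le> (\<Sum>j\<in>UNIV. (CL + cm * matnorm k (D e)) * wnorm a b (Suc k) (\<lambda>x. v j e x - u j x))"
      unfolding matnorm_def [of k "D e"] by (intro sum_mono)
    then show ?thesis
      by (simp add: t_def sum_distrib_left)
  qed
  have "((\<lambda>e. cm * t e) \<longlongrightarrow> cm * 0) (at_right 0)"
    by (intro tendsto_intros limt)
  then have "\<forall>\<^sub>F e in at_right 0. cm * t e < 1 / 2"
    by (rule order_tendstoD) simp
  \<comment> \<open>When \<open>cm * t e < 1 / 2\<close>, at most half of
    \<open>matnorm k (D e)\<close> stands on the right; absorbing it doubles the rest.\<close>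
  then have ev: "\<forall>\<^sub>F e in at_right 0. norm (matnorm k (D e)) \<le> 2 * CL * t e"
    using eventually_at_right_0 [OF \<open>0 < \<delta>\<close>]
  proof eventually_elim
    case (elim e)
    then have m: "0 \<le> matnorm k (D e)"
      unfolding matnorm_def by (intro sum_nonneg wnorm_nonneg DW) auto
    have "matnorm k (D e) \<le> CL * t e + (cm * t e) * matnorm k (D e)"
      using mD [of e] elim by (simp add: algebra_simps)
    also have "(cm * t e) * matnorm k (D e) \<le> 1 / 2 * matnorm k (D e)"
      using elim m by (intro mult_right_mono) auto
    finally show ?case
      using m by simp
  qed
  have "((\<lambda>e. 2 * CL * t e) \<longlongrightarrow> 2 * CL * 0) (at_right 0)"
    by (intro tendsto_intros limt)
  then have limD: "((\<lambda>e. matnorm k (D e)) \<longlongrightarrow> 0) (at_right 0)"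
    by (intro Lim_null_comparison [OF ev]) simp

  define g where "g e = (\<lambda>x. Lop a b (A e) y x - Lop a b (A 0) y x)" for e
  have g_eq: "g e = (\<lambda>x. D e x *v y x)" for e
    unfolding g_def D_def by (simp add: Lop_perturb [of "A e" _ _ "A 0"])
  have gW: "Wk a b k (g e)" if "0 \<le> e" "e < \<delta>" for e
    unfolding g_eq by (rule Dz(1) [OF that y])
  have "((\<lambda>e. cm * matnorm k (D e) * wnorm a b (Suc k) y) \<longlongrightarrow> cm * 0 * wnorm a b (Suc k) y) (at_right 0)"
    by (intro tendsto_intros limD)
  then have lim': "((\<lambda>e. cm * matnorm k (D e) * wnorm a b (Suc k) y) \<longlongrightarrow> 0) (at_right 0)"
    by simp
  have "norm (wnorm a b k (g e)) \<le> cm * matnorm k (D e) * wnorm a b (Suc k) y" if "0 < e \<and> e < \<delta>" for e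
    using Dz(2) [of e y] that y wnorm_nonneg [OF gW [of e]] by (simp add: g_eq)
  then have limg: "((\<lambda>e. wnorm a b k (g e)) \<longlongrightarrow> 0) (at_right 0)"
    by (intro Lim_null_comparison [OF eventually_mono [OF eventually_at_right_0 [OF \<open>0 < \<delta>\<close>]] lim'])
  then show "((\<lambda>e. wnorm a b k (\<lambda>x. Lop a b (A e) y x - Lop a b (A 0) y x)) \<longlongrightarrow> 0) (at_right 0)"
    unfolding g_def .

  \<comment> \<open>In \<open>S e (g e) 0\<close> the argument varies with the parameter, so strong
    convergence alone says nothing about it. The uniform bound from Banach-Steinhaus does.\<close>
  have "\<exists>\<eta>>0. \<exists>M\<ge>0. \<forall>e f. 0 < e \<longrightarrow> e < \<eta> \<longrightarrow> Wk a b k f \<longrightarrow> wnorm a b (Suc k) (S e f 0) \<le> M * wnorm a b k f"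
  proof (rule uniform_boundedness [OF \<open>0 < \<delta>\<close>])
    fix e c and f h :: "real \<Rightarrow> complex ^ 'm" assume e: "0 < e" "e < \<delta>" and f: "Wk a b k f"
    have Se: "is_inverse a b (Suc k) (A e) (B e) (S e)"
      using S e by simp
    note fW = inverse_Wk [OF Se f]
    show "wnorm a b (Suc k) (S e (\<lambda>x. c *s f x) 0) \<le> cmod c * wnorm a b (Suc k) (S e f 0)"
      using wnorm_aeq [OF inverse_smult [OF Se f, of c 0], of "Suc k"] wnorm_smult_le [OF fW, of c 0] by simp
    assume h: "Wk a b k h"
    show "wnorm a b (Suc k) (S e (\<lambda>x. f x + h x) 0) \<le> wnorm a b (Suc k) (S e f 0) + wnorm a b (Suc k) (S e h 0)"
      using wnorm_aeq [OF inverse_add [OF Se f h, of 0 0], of "Suc k"] wnorm_add_le [OF fW inverse_Wk [OF Se h], of 0 0] by simp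
  next
    fix e assume e: "0 < e" "e < \<delta>"
    obtain C where C: "\<And>f c. Wk a b k f \<Longrightarrow> wnorm a b (Suc k) (S e f c) \<le> C * (wnorm a b k f + norm c)"
      using inverse_bound [OF S [of e]] e by auto
    show "\<exists>C. \<forall>f. Wk a b k f \<longrightarrow> wnorm a b (Suc k) (S e f 0) \<le> C * wnorm a b k f"
      using C [of _ 0] by auto
  next
    fix f :: "real \<Rightarrow> complex ^ 'm" assume f: "Wk a b k f"
    have "\<forall>\<^sub>F e in at_right 0. wnorm a b (Suc k) (\<lambda>x. S e f 0 x - S 0 f 0 x) < 1"
      using limS [OF f] by (rule order_tendstoD) simp
    then have "\<forall>\<^sub>F e in at_right 0. wnorm a b (Suc k) (S e f 0) \<le> 1 + wnorm a b (Suc k) (S 0 f 0)"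
      using eventually_at_right_0 [OF \<open>0 < \<delta>\<close>]
    proof eventually_elim
      case (elim e)
      have Se: "is_inverse a b (Suc k) (A e) (B e) (S e)"
        using S elim by simp
      show ?case
        using wnorm_add_le [OF Wk_diff [OF inverse_Wk [OF Se f] inverse_Wk [OF S0 f]] inverse_Wk [OF S0 f], of 0 0 0] elim by simp
    qed
    then show "\<exists>C. \<forall>\<^sub>F e in at_right 0. wnorm a b (Suc k) (S e f 0) \<le> C" ..
  qed
  then obtain \<eta> M where M: "0 < \<eta>" "0 \<le> M"
    "\<And>e f. 0 < e \<Longrightarrow> e < \<eta> \<Longrightarrow> Wk a b k f \<Longrightarrow> wnorm a b (Suc k) (S e f 0) \<le> M * wnorm a b k f"
    by blast

  \<comment> \<open>\<open>R e\<close> is the error of the inverse at the data of \<open>y\<close>,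
    and \<open>s e\<close> controls, through the basis vectors, the error of the solutions with zero
    right-hand side.\<close>
  define w where "w e = B e y - B 0 y" for e
  define R where "R e = wnorm a b (Suc k) (\<lambda>x. S e (Lop a b (A 0) y) (B 0 y) x - S 0 (Lop a b (A 0) y) (B 0 y) x)" for e
  define s where "s e = (\<Sum>j\<in>UNIV. CB * wnorm a b (Suc k) (\<lambda>x. S e (\<lambda>x. 0) (axis j 1) x - S 0 (\<lambda>x. 0) (axis j 1) x))" for e
  have L0y: "Wk a b k (Lop a b (A 0) y)"
    by (rule Lop_Wk [OF A0 y])
  have limR: "(R \<longlongrightarrow> 0) (at_right 0)"
    unfolding R_def by (rule limS [OF L0y])
  have "((\<lambda>e. CB * wnorm a b (Suc k) (\<lambda>x. S e (\<lambda>x. 0) (axis j 1) x - S 0 (\<lambda>x. 0) (axis j 1) x)) \<longlongrightarrow> 0) (at_right 0)" for j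
    using tendsto_mult_left [OF limS [OF Wk_const [of k 0], of "axis j 1"], of CB] by simp
  then have lims: "(s \<longlongrightarrow> 0) (at_right 0)"
    unfolding s_def by (intro tendsto_null_sum)
  have main: "norm (w e) \<le> CB * (R e + M * wnorm a b k (g e)) + s e * norm (w e)" if e: "0 < e" "e < \<delta>" "e < \<eta>" for e
  proof -
    have e0: "0 \<le> e"
      using e by simp
    note Se = S [OF e0 e(2)] and ge = gW [OF e0 e(2)] and Ley = Lop_Wk [OF A [OF e0 e(2)] y]
    have Z: "Wk a b (Suc k) (S e (\<lambda>x. 0) z)" and Z0: "Wk a b (Suc k) (S 0 (\<lambda>x. 0) z)" for z
      by (rule inverse_Wk [OF Se Wk_const] inverse_Wk [OF S0 Wk_const])+
    let ?p = "\<lambda>x. S 0 (Lop a b (A 0) y) (B 0 y) x - S e (Lop a b (A 0) y) (B 0 y) x"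
    have p: "Wk a b (Suc k) ?p" "wnorm a b (Suc k) ?p = R e"
      unfolding R_def using Wk_diff wnorm_minus_commute inverse_Wk [OF Se L0y] inverse_Wk [OF S0 L0y] by blast+
    have "aeq a b (S e (g e) (w e)) (\<lambda>x. S e (Lop a b (A e) y) (B e y) x - S e (Lop a b (A 0) y) (B 0 y) x)"
      unfolding g_def w_def by (rule inverse_diff [OF Se Ley L0y])
    \<comment> \<open>Each inverse reproduces \<open>y\<close> from its own data, so
      \<open>y\<close> may be rewritten with \<open>S 0\<close>; what remains compares the two
      inverses at common data.\<close>
    then have "aeq a b (S e (g e) (w e)) ?p"
      using inverse_left [OF Se y] inverse_left [OF S0 y] unfolding aeq_def by eventually_elim simp
    moreover have "aeq a b (S e (g e) (w e)) (\<lambda>x. S e (g e) 0 x + S e (\<lambda>x. 0) (w e) x)"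
      using inverse_add [OF Se ge Wk_const [of k 0], of 0 "w e"] by simp
    ultimately have "aeq a b (S e (\<lambda>x. 0) (w e)) (\<lambda>x. ?p x - S e (g e) 0 x)"
      unfolding aeq_def by eventually_elim (simp add: algebra_simps)
    then have "wnorm a b (Suc k) (S e (\<lambda>x. 0) (w e)) = wnorm a b (Suc k) (\<lambda>x. ?p x - S e (g e) 0 x)"
      by (rule wnorm_aeq)
    also have "\<dots> \<le> R e + M * wnorm a b k (g e)"
      using wnorm_diff_le [OF p(1) inverse_Wk [OF Se ge], of 0] p(2) M(3) [OF e(1,3) ge] by simp
    finally have "CB * wnorm a b (Suc k) (S e (\<lambda>x. 0) (w e)) \<le> CB * (R e + M * wnorm a b k (g e))"
      by (rule mult_left_mono [OF _ CB(1)])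
    then have 1: "norm (B 0 (S e (\<lambda>x. 0) (w e))) \<le> CB * (R e + M * wnorm a b k (g e))"
      using CB(2) [OF Z, of "w e"] by linarith
    \<comment> \<open>Since \<open>B 0 (S 0 (\<lambda>x. 0) z) = z\<close>, \<open>G\<close>
      measures how far this identity fails for \<open>S e\<close>. Its values at the basis vectors
      are therefore bounded by convergence of the inverses.\<close>
    define G where "G z = B 0 (S e (\<lambda>x. 0) z) - z" for z
    have "G (c *s z + z') = c *s G z + G z'" for c z z'
    proof -
      have "B 0 (S e (\<lambda>x. 0) (c *s z + z')) = c *s B 0 (S e (\<lambda>x. 0) z) + B 0 (S e (\<lambda>x. 0) z')"
        using functional_aeq [OF B0 Z inverse_smult_add_0 [OF Se]] functional_smult_add [OF B0 Z Z] by simp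
      then show ?thesis
        by (simp add: G_def vector_ssub_ldistrib)
    qed
    then have "norm (G (w e)) \<le> (\<Sum>j\<in>UNIV. norm (G (axis j 1))) * norm (w e)"
      by (rule complex_linear_bound)
    also have "\<dots> \<le> s e * norm (w e)"
    proof (rule mult_right_mono)
      have "norm (G (axis j 1)) \<le> CB * wnorm a b (Suc k) (\<lambda>x. S e (\<lambda>x. 0) (axis j 1) x - S 0 (\<lambda>x. 0) (axis j 1) x)" for j
        using CB(2) [OF Wk_diff [OF Z Z0], of "axis j 1" "axis j 1"]
        unfolding G_def functional_diff [OF B0 Z Z0] inverse_functional [OF S0 Wk_const] .
      then show "(\<Sum>j\<in>UNIV. norm (G (axis j 1))) \<le> s e"
        unfolding s_def by (intro sum_mono)
    qed simp
    finally have 2: "norm (G (w e)) \<le> s e * norm (w e)" .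
    have "norm (w e) \<le> norm (B 0 (S e (\<lambda>x. 0) (w e))) + norm (G (w e))"
      using norm_triangle_ineq4 [of "B 0 (S e (\<lambda>x. 0) (w e))" "G (w e)"] by (simp add: G_def)
    then show ?thesis
      using 1 2 by linarith
  qed
  have "\<forall>\<^sub>F e in at_right 0. s e < 1 / 2"
    using lims by (rule order_tendstoD) simp
  \<comment> \<open>Where \<open>s e < 1 / 2\<close>, the last term of \<open>main\<close> is
    absorbed on the left, which doubles the rest.\<close>
  then have ev: "\<forall>\<^sub>F e in at_right 0. norm (w e) \<le> 2 * (CB * (R e + M * wnorm a b k (g e)))"
    using eventually_at_right_0 [OF \<open>0 < \<delta>\<close>] eventually_at_right_0 [OF M(1)]
  proof eventually_elim
    case (elim e)
    then have "s e * norm (w e) \<le> 1 / 2 * norm (w e)"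
      by (intro mult_right_mono) auto
    then show ?case
      using main [of e] elim by simp
  qed
  have "((\<lambda>e. 2 * (CB * (R e + M * wnorm a b k (g e)))) \<longlongrightarrow> 2 * (CB * (0 + M * 0))) (at_right 0)"
    by (intro tendsto_intros limR limg)
  then have "(w \<longlongrightarrow> 0) (at_right 0)"
    by (intro Lim_null_comparison [OF ev]) simp
  then show "((\<lambda>e. B e y) \<longlongrightarrow> B 0 y) (at_right 0)"
    unfolding w_def by (simp add: LIM_zero_iff)
qed

end

theorem theorem4:
  fixes a b \<epsilon>0 :: real and n :: nat
    and A :: "real \<Rightarrow> real \<Rightarrow> complex ^ 'm ^ 'm"
    and B :: "real \<Rightarrow> (real \<Rightarrow> complex ^ 'm) \<Rightarrow> complex ^ 'm"
  assumes "a < b" and "n \<ge> 1" and "\<epsilon>0 > 0"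
    and "\<And>\<epsilon> i j. \<epsilon> \<in> {0..<\<epsilon>0} \<Longrightarrow> Wk a b (n - 1) (\<lambda>x. A \<epsilon> x $ i $ j)"
    and "\<And>\<epsilon>. \<epsilon> \<in> {0..<\<epsilon>0} \<Longrightarrow> bdd_lin_B a b n (B \<epsilon>)"
    and "\<exists>S0. is_inverse a b n (A 0) (B 0) S0"
  shows "(\<exists>\<delta>>0. \<exists>S. (\<forall>\<epsilon>\<in>{0..<min \<delta> \<epsilon>0}. is_inverse a b n (A \<epsilon>) (B \<epsilon>) (S \<epsilon>)) \<and>
            (\<forall>f c. Wk a b (n - 1) f \<longrightarrow>
               ((\<lambda>\<epsilon>. wnorm a b n (\<lambda>x. S \<epsilon> f c x - S 0 f c x)) \<longlongrightarrow> 0) (at_right 0)))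
     \<longleftrightarrow>
     (\<forall>y. Wk a b n y \<longrightarrow>
        ((\<lambda>\<epsilon>. wnorm a b (n - 1) (\<lambda>x. Lop a b (A \<epsilon>) y x - Lop a b (A 0) y x)) \<longlongrightarrow> 0) (at_right 0) \<and>
        ((\<lambda>\<epsilon>. B \<epsilon> y) \<longlongrightarrow> B 0 y) (at_right 0))"
    (is "?inverses \<longleftrightarrow> ?operators")
proof -
  interpret interval a b
    using \<open>a < b\<close> by unfold_locales
  \<comment> \<open>As \<open>n\<close> is positive, \<open>n - 1\<close> becomes \<open>k\<close>
    and truncated subtraction disappears.\<close>
  obtain k where n: "n = Suc k"
    using \<open>n \<ge> 1\<close> by (cases n) auto
  have A: "Wk a b k (\<lambda>x. column j (A e x))" if "0 \<le> e" "e < \<epsilon>0" for e j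
    using assms(4) [of e] that unfolding n diff_Suc_1 by (intro Wk_column) simp
  have B: "bdd_lin_B a b (Suc k) (B e)" if "0 \<le> e" "e < \<epsilon>0" for e
    using assms(5) [of e] that unfolding n by simp
  obtain S0 where S0: "is_inverse a b (Suc k) (A 0) (B 0) S0"
    using assms(6) unfolding n ..
  show ?thesis
  proof
    assume ?inverses
    then obtain \<delta> S where \<delta>: "0 < \<delta>"
      and S: "\<And>e. e \<in> {0..<min \<delta> \<epsilon>0} \<Longrightarrow> is_inverse a b (Suc k) (A e) (B e) (S e)"
      and lim: "\<And>f c. Wk a b k f \<Longrightarrow> ((\<lambda>e. wnorm a b (Suc k) (\<lambda>x. S e f c x - S 0 f c x)) \<longlongrightarrow> 0) (at_right 0)"
      unfolding n diff_Suc_1 by blast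
    \<comment> \<open>The inverses are given only below this minimum, where the hypotheses on
      \<open>A\<close> and \<open>B\<close> hold as well.\<close>
    have pos: "0 < min \<delta> \<epsilon>0"
      using \<delta> \<open>\<epsilon>0 > 0\<close> by simp
    show ?operators
      unfolding n diff_Suc_1
      using inverses_converge_imp_strong_convergence [where A = A and B = B and S = S, OF pos _ _ _ lim] A B S
      by simp
  next
    assume ?operators
    then show ?inverses
      unfolding n diff_Suc_1
      by (intro strong_convergence_imp_inverses_converge [where A = A and B = B, OF \<open>\<epsilon>0 > 0\<close> A B S0]) blast+
  qed
qed

end
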